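(* Let $S$ be a subsemigroup of $((0,\infty),+)$ which is dense in $(0,\infty)$ and such that for each $c\in\mathbb N$ the set $cS=\{cs:s\in S\}$ is central$^*$ near zero. Let $u,v\in\mathbb N$ and let $A$ be a $u\times v$ matrix with entries from $\mathbb Q$. The following are equivalent: (a) $A$ is image partition regular; (b) for each subset $C$ of $S$ which is central near zero, there exists $\vec x\in S^v$ such that $A\vec x\in C^u$.
   Context: For a discrete set $X$, $\beta X$ is the set of ultrafilters on $X$. The addition of $S$ extends to $\beta S$ via: $B\in p+q$ iff $\{x\in S: -x+B\in q\}\in p$, where $-x+B=\{y\in S:x+y\in B\}$; this makes $\beta S$ a compact right topological semigroup. $O^+(S)=\{p\in\beta S:(0,\varepsilon)\cap S\in p$ for all $\varepsilon>0\}$ is a compact subsemigroup; $K(O^+(S))$ denotes its smallest two-sided ideal. A set $C\subseteq S$ is central near zero if there is an idempotent $p\in K(O^+(S))$ with $C\in p$. A set is central$^*$ near zero if it belongs to every idempotent of $K(O^+(S))$ (equivalently, meets every set which is central near zero). A $u\times v$ rational matrix $A$ is image partition regular if it has no zero row and whenever $\mathbb N$ is finitely colored there is $\vec x\in\mathbb N^v$ such that all entries of $A\vec x$ have the same color. *)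

theory Defs
  imports "HOL-Analysis.Elementary_Topology" "Jordan_Normal_Form.Matrix"
begin

text \<open>
  An ultrafilter on \<open>S\<close> is represented by the set of its members, all of which are subsets of \<open>S\<close>.
\<close>

definition ultrafilter_on :: "'a set \<Rightarrow> 'a set set \<Rightarrow> bool" where
  "ultrafilter_on S p \<longleftrightarrow>
     p \<subseteq> Pow S \<and> S \<in> p \<and> {} \<notin> p \<and>
     (\<forall>A\<in>p. \<forall>B\<in>p. A \<inter> B \<in> p) \<and>
     (\<forall>A\<in>p. \<forall>B. A \<subseteq> B \<and> B \<subseteq> S \<longrightarrow> B \<in> p) \<and>
     (\<forall>A. A \<subseteq> S \<longrightarrow> A \<in> p \<or> S - A \<in> p)"

definition ultrafilters :: "'a set \<Rightarrow> 'a set set set" where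
  "ultrafilters S = {p. ultrafilter_on S p}"

definition ultrafilter_plus :: "'a::plus set \<Rightarrow> 'a set set \<Rightarrow> 'a set set \<Rightarrow> 'a set set" where
  "ultrafilter_plus S p q = {B. B \<subseteq> S \<and> {x\<in>S. {y\<in>S. x + y \<in> B} \<in> q} \<in> p}"

definition two_sided_ideal :: "'b set \<Rightarrow> ('b \<Rightarrow> 'b \<Rightarrow> 'b) \<Rightarrow> 'b set \<Rightarrow> bool" where
  "two_sided_ideal T f I \<longleftrightarrow>
     I \<subseteq> T \<and> I \<noteq> {} \<and> (\<forall>t\<in>T. \<forall>x\<in>I. f t x \<in> I \<and> f x t \<in> I)"

text \<open>
  The smallest two-sided ideal of a semigroup, whenever one exists, is the intersection of all of
  them. It does exist for compact right topological semigroups.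
\<close>

definition smallest_ideal :: "'b set \<Rightarrow> ('b \<Rightarrow> 'b \<Rightarrow> 'b) \<Rightarrow> 'b set" where
  "smallest_ideal T f = \<Inter> {I. two_sided_ideal T f I}"

definition O_plus :: "real set \<Rightarrow> real set set set" where
  "O_plus S = {p \<in> ultrafilters S. \<forall>\<epsilon>>0. {0<..<\<epsilon>} \<inter> S \<in> p}"

definition minimal_idempotents_near_zero :: "real set \<Rightarrow> real set set set" where
  "minimal_idempotents_near_zero S =
     {p \<in> smallest_ideal (O_plus S) (ultrafilter_plus S). ultrafilter_plus S p p = p}"

definition central_near_zero :: "real set \<Rightarrow> real set \<Rightarrow> bool" where
  "central_near_zero S C \<longleftrightarrow> C \<subseteq> S \<and> (\<exists>p \<in> minimal_idempotents_near_zero S. C \<in> p)"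

definition central_star_near_zero :: "real set \<Rightarrow> real set \<Rightarrow> bool" where
  "central_star_near_zero S C \<longleftrightarrow> C \<subseteq> S \<and> (\<forall>p \<in> minimal_idempotents_near_zero S. C \<in> p)"

text \<open>
  Here the natural numbers are the positive integers. A finite colouring is a map \<open>\<chi>\<close> taking
  finitely many values on them. That all entries of \<open>A x\<close> have the same colour includes that they
  are positive integers.
\<close>

definition image_partition_regular :: "rat mat \<Rightarrow> bool" where
  "image_partition_regular A \<longleftrightarrow>
     (\<forall>i < dim_row A. row A i \<noteq> 0\<^sub>v (dim_col A)) \<and>
     (\<forall>\<chi> :: nat \<Rightarrow> nat. finite (\<chi> ` {0<..}) \<longrightarrow>
        (\<exists>x \<in> carrier_vec (dim_col A).
           (\<forall>j < dim_col A. x $ j > 0) \<and>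
           (\<exists>c. \<forall>i < dim_row A. \<exists>n>0.
              (A *\<^sub>v map_vec of_nat x) $ i = of_nat n \<and> \<chi> n = c)))"

end

theory Submission
  imports Defs "HOL-Analysis.Kronecker_Approximation_Theorem" "HOL-Library.Function_Algebras"
begin

text \<open>
  Rado's argument: colouring integers by the integer part of their logarithm, modulo a large number,
  groups the entries of a monochromatic image of \<open>A\<close> into blocks of widely different magnitude. In the
  limit one gets, for each block, a nonnegative combination of the columns of \<open>A\<close> that equals 1 on that
  block and 0 on all blocks of smaller magnitude. Clearing denominators yields a nonnegative integer
  matrix \<open>H\<close> such that \<open>A H\<close> is a first entries matrix with nonnegative integer entries and all first
  entries equal to some \<open>d\<close>.

  Images of such matrices are found in a central set \<open>C \<in> p\<close> one block at a time, working in the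
  semigroup of ultrafilters on tuples. Let \<open>w\<close> range over the ultrafilters that the blocks treated so far
  send to \<open>p\<close>, and let \<open>P\<close> be the copy of \<open>p / d\<close> on the next coordinate axis, which exists as \<open>d S \<in> p\<close>.
  Some \<open>e = w + P\<close> is idempotent. Each form of the new block sends \<open>P\<close> to \<open>p\<close>, hence \<open>e\<close> to an idempotent
  in the minimal left ideal of \<open>p\<close>, hence \<open>P + e\<close> to \<open>p\<close>.

  Conversely, a colouring of the positive integers is pulled back to \<open>S\<close> by simultaneous Diophantine
  approximation.
\<close>

text \<open>Addition of ultrafilters is continuous in its left argument only. This is why the
  idempotent is sought in the form \<open>w + P\<close>: right translation by \<open>P\<close> keeps
  sets closed, and every new form sends \<open>w + P\<close> into the left ideal of
  \<open>p\<close>. The hypothesis on \<open>c S\<close> enters at \<open>c = d\<close>, because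
  \<open>S\<close> need not admit division by \<open>d\<close>. Coefficients have to be nonnegative
  because \<open>S\<close> has no negative elements, and 0 has to be adjoined to \<open>S\<close>
  for coordinate axes to exist, so forms that vanish almost everywhere need separate treatment. In
  Rado's argument the approximate solutions may be unbounded as the tolerance shrinks; instead of a
  convergent subsequence, the closedness of finitely generated cones is used. In the converse, the
  colouring of \<open>S\<close> must be fixed before it is known which finitely many reals will be
  related, hence a limit along an ultrafilter.\<close>

unbundle no vec_syntax

subsection \<open>Closed sets of ultrafilters\<close>

lemma ultrafilter_onD:
  assumes "ultrafilter_on S p"
  shows "\<And>B. B \<in> p \<Longrightarrow> B \<subseteq> S" "S \<in> p" "{} \<notin> p"
    "\<And>A B. A \<in> p \<Longrightarrow> B \<in> p \<Longrightarrow> A \<inter> B \<in> p"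
    "\<And>A B. A \<in> p \<Longrightarrow> A \<subseteq> B \<Longrightarrow> B \<subseteq> S \<Longrightarrow> B \<in> p"
    "\<And>A. A \<subseteq> S \<Longrightarrow> A \<in> p \<or> S - A \<in> p"
proof -
  note U = assms[unfolded ultrafilter_on_def]
  show "B \<subseteq> S" if "B \<in> p" for B using conjunct1[OF U] that by auto
  show "S \<in> p" "{} \<notin> p" using U by simp_all
  show "A \<inter> B \<in> p" if "A \<in> p" "B \<in> p" for A B using U that by simp
  show "B \<in> p" if "A \<in> p" "A \<subseteq> B" "B \<subseteq> S" for A B
    using U[THEN conjunct2, THEN conjunct2, THEN conjunct2, THEN conjunct2, THEN conjunct1] that
    by simp
  show "A \<in> p \<or> S - A \<in> p" if "A \<subseteq> S" for A using U that by simp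
qed

lemma ultrafilter_on_compl:
  assumes "ultrafilter_on S p" "A \<subseteq> S"
  shows "S - A \<in> p \<longleftrightarrow> A \<notin> p"
proof -
  have "A \<inter> (S - A) = {}" by blast
  then show ?thesis
    using ultrafilter_onD[OF assms(1)] assms(2) by metis
qed

lemma ultrafilter_on_eqI:
  assumes "ultrafilter_on S p" "ultrafilter_on S q" "p \<subseteq> q"
  shows "p = q"
proof (rule antisym[OF assms(3)], rule subsetI)
  fix B assume B: "B \<in> q"
  then have "B \<subseteq> S" "S - B \<notin> q"
    using ultrafilter_onD(1)[OF assms(2)] ultrafilter_on_compl[OF assms(2)] by blast+
  then show "B \<in> p"
    using assms(3) ultrafilter_onD(6)[OF assms(1)] by blast
qed

text \<open>The factor \<open>S\<close> matters for the empty family, whose intersection is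
  \<open>UNIV\<close>.\<close>

lemma ultrafilter_on_Inter:
  assumes "ultrafilter_on S p" "finite \<G>" "\<G> \<subseteq> p"
  shows "S \<inter> \<Inter>\<G> \<in> p"
  using assms(2,3)
proof induction
  case empty
  then show ?case using ultrafilter_onD(2)[OF assms(1)] by simp
next
  case (insert G \<G>)
  then have "G \<inter> (S \<inter> \<Inter>\<G>) \<in> p"
    using ultrafilter_onD(4)[OF assms(1)] by blast
  then show ?case by (simp add: Int_left_commute)
qed

lemma ultrafilter_on_finite_Ball:
  assumes "ultrafilter_on S p" "finite I" "\<And>i. i \<in> I \<Longrightarrow> {x\<in>S. P i x} \<in> p"
  shows "{x\<in>S. \<forall>i\<in>I. P i x} \<in> p"
proof -
  have "S \<inter> (\<Inter>i\<in>I. {x\<in>S. P i x}) \<in> p"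
    using assms by (intro ultrafilter_on_Inter) auto
  moreover have "S \<inter> (\<Inter>i\<in>I. {x\<in>S. P i x}) = {x\<in>S. \<forall>i\<in>I. P i x}" by auto
  ultimately show ?thesis by simp
qed

lemma ultrafilter_on_finite_Bex:
  assumes "ultrafilter_on S p" "finite I" "{x\<in>S. \<exists>i\<in>I. P i x} \<in> p"
  shows "\<exists>i\<in>I. {x\<in>S. P i x} \<in> p"
proof (rule ccontr)
  assume neg: "\<not> ?thesis"
  have "{x\<in>S. \<not> P i x} \<in> p" if "i \<in> I" for i
  proof -
    have "S - {x\<in>S. P i x} \<in> p"
      using neg that ultrafilter_on_compl[OF assms(1), of "{x\<in>S. P i x}"] by blast
    moreover have "S - {x\<in>S. P i x} = {x\<in>S. \<not> P i x}" by auto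
    ultimately show ?thesis by simp
  qed
  then have "{x\<in>S. \<forall>i\<in>I. \<not> P i x} \<in> p"
    using ultrafilter_on_finite_Ball[OF assms(1,2), of "\<lambda>i x. \<not> P i x"] by blast
  then have "{x\<in>S. \<forall>i\<in>I. \<not> P i x} \<inter> {x\<in>S. \<exists>i\<in>I. P i x} \<in> p"
    using ultrafilter_onD(4)[OF assms(1)] assms(3) by blast
  moreover have "{x\<in>S. \<forall>i\<in>I. \<not> P i x} \<inter> {x\<in>S. \<exists>i\<in>I. P i x} = {}" by auto
  ultimately show False using ultrafilter_onD(3)[OF assms(1)] by simp
qed

text \<open>Zorn's lemma is applied to families with the finite intersection property rather than to
  filters: a maximal such family turns out to be closed under finite intersections and supersets by
  itself.\<close>

lemma ultrafilter_on_extension: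
  assumes "\<F> \<subseteq> Pow S" and fip: "\<And>\<G>. finite \<G> \<Longrightarrow> \<G> \<subseteq> \<F> \<Longrightarrow> S \<inter> \<Inter>\<G> \<noteq> {}"
  shows "\<exists>p. ultrafilter_on S p \<and> \<F> \<subseteq> p"
proof -
  define \<A> where "\<A> = {\<G>. \<F> \<subseteq> \<G> \<and> \<G> \<subseteq> Pow S \<and> (\<forall>\<H>. finite \<H> \<and> \<H> \<subseteq> \<G> \<longrightarrow> S \<inter> \<Inter>\<H> \<noteq> {})}"
  have "\<exists>p\<in>\<A>. \<forall>\<G>\<in>\<A>. p \<subseteq> \<G> \<longrightarrow> \<G> = p"
  proof (rule subset_Zorn_nonempty)
    have "\<F> \<in> \<A>" using assms by (simp add: \<A>_def)
    then show "\<A> \<noteq> {}" by blast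
    fix \<C> assume \<C>: "\<C> \<noteq> {}" "subset.chain \<A> \<C>"
    have sub: "\<C> \<subseteq> \<A>" using \<C>(2) by (simp add: subset_chain_def)
    have "S \<inter> \<Inter>\<H> \<noteq> {}" if "finite \<H>" "\<H> \<subseteq> \<Union>\<C>" for \<H>
    proof -
      note \<H> = that
      obtain \<G> where \<G>: "\<G> \<in> \<C>" "\<H> \<subseteq> \<G>"
        by (rule finite_subset_Union_chain[OF \<H> \<C>])
      then have "\<G> \<in> \<A>" using sub by blast
      then show ?thesis using \<G>(2) \<H>(1) by (simp add: \<A>_def)
    qed
    moreover have "\<F> \<subseteq> \<G>" "\<G> \<subseteq> Pow S" if "\<G> \<in> \<C>" for \<G>
      using subsetD[OF sub that] by (simp_all add: \<A>_def)
    then have "\<F> \<subseteq> \<Union>\<C>" "\<Union>\<C> \<subseteq> Pow S" using \<C>(1) by (blast, blast)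
    ultimately show "\<Union>\<C> \<in> \<A>" by (simp add: \<A>_def)
  qed
  then obtain p where p: "p \<in> \<A>" and max: "\<forall>\<G>\<in>\<A>. p \<subseteq> \<G> \<longrightarrow> \<G> = p" by blast
  have pow: "p \<subseteq> Pow S" and sub: "\<F> \<subseteq> p"
    and pfip: "\<And>\<H>. finite \<H> \<Longrightarrow> \<H> \<subseteq> p \<Longrightarrow> S \<inter> \<Inter>\<H> \<noteq> {}"
    using p by (simp_all add: \<A>_def)
  \<comment> \<open>Maximality in usable form: a set compatible with all finite intersections
    already belongs to the family.\<close>
  have add: "A \<in> p" if A: "A \<subseteq> S" and meets: "\<And>\<H>. finite \<H> \<Longrightarrow> \<H> \<subseteq> p \<Longrightarrow> S \<inter> \<Inter>\<H> \<inter> A \<noteq> {}" for A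
  proof -
    have "S \<inter> \<Inter>\<H> \<noteq> {}" if \<H>: "finite \<H>" "\<H> \<subseteq> insert A p" for \<H>
    proof -
      have "S \<inter> \<Inter>(\<H> - {A}) \<inter> A \<noteq> {}" using \<H> by (intro meets) auto
      then show ?thesis by blast
    qed
    then have "insert A p \<in> \<A>" using A pow sub by (simp add: \<A>_def subset_insertI2)
    then show ?thesis using max[rule_format, of "insert A p"] by blast
  qed
  have fin: "B \<in> p" if "finite \<H>" "\<H> \<subseteq> p" "S \<inter> \<Inter>\<H> \<subseteq> B" "B \<subseteq> S" for B \<H>
  proof (rule add[OF that(4)])
    fix \<K> assume "finite \<K>" "\<K> \<subseteq> p"
    then have "S \<inter> \<Inter>(\<H> \<union> \<K>) \<noteq> {}" using that by (intro pfip) auto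
    then show "S \<inter> \<Inter>\<K> \<inter> B \<noteq> {}" using that(3) by blast
  qed
  have "ultrafilter_on S p"
    unfolding ultrafilter_on_def
  proof (intro conjI ballI allI impI)
    show "S \<in> p" by (rule fin[of "{}"]) auto
    show "{} \<notin> p" using pfip[of "{{}}"] by auto
    show "A \<inter> B \<in> p" if "A \<in> p" "B \<in> p" for A B
      using that pow by (intro fin[of "{A, B}"]) auto
    show "B \<in> p" if "A \<in> p" "A \<subseteq> B \<and> B \<subseteq> S" for A B
      using that by (intro fin[of "{A}"]) auto
    show "A \<in> p \<or> S - A \<in> p" if A: "A \<subseteq> S" for A
    proof (rule disjCI)
      assume "S - A \<notin> p"
      show "A \<in> p"
      proof (rule add[OF A] , rule notI)
        fix \<H> assume \<H>: "finite \<H>" "\<H> \<subseteq> p" "S \<inter> \<Inter>\<H> \<inter> A = {}"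
        then have "S - A \<in> p" by (intro fin[OF \<H>(1,2)]) auto
        then show False using \<open>S - A \<notin> p\<close> by blast
      qed
    qed
  qed (use pow in blast)
  then show ?thesis using sub by blast
qed

text \<open>The closed subsets of the Stone-Cech compactification correspond to filters.\<close>

definition ultra_closed :: "'a set \<Rightarrow> 'a set set set \<Rightarrow> bool" where
  "ultra_closed S Z \<longleftrightarrow> (\<exists>\<F>. Z = {p. ultrafilter_on S p \<and> \<F> \<subseteq> p})"

lemma ultra_closedI: "ultra_closed S {p. ultrafilter_on S p \<and> \<F> \<subseteq> p}"
  unfolding ultra_closed_def by blast

lemma ultra_closed_imp_ultrafilter: "ultra_closed S Z \<Longrightarrow> p \<in> Z \<Longrightarrow> ultrafilter_on S p"
  unfolding ultra_closed_def by blast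

text \<open>A closed set is recovered from its filter \<open>\<Inter>Z\<close>, the largest family
  that defines it.\<close>

lemma ultra_closed_memI: "ultra_closed S Z \<Longrightarrow> ultrafilter_on S p \<Longrightarrow> \<Inter>Z \<subseteq> p \<Longrightarrow> p \<in> Z"
  unfolding ultra_closed_def by blast

lemma ultra_closed_Int:
  assumes "ultra_closed S Y" "ultra_closed S Z"
  shows "ultra_closed S (Y \<inter> Z)"
proof -
  obtain \<F> \<G> where "Y = {p. ultrafilter_on S p \<and> \<F> \<subseteq> p}" "Z = {p. ultrafilter_on S p \<and> \<G> \<subseteq> p}"
    using assms unfolding ultra_closed_def by blast
  then have "Y \<inter> Z = {p. ultrafilter_on S p \<and> \<F> \<union> \<G> \<subseteq> p}" by blast
  then show ?thesis using ultra_closedI by metis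
qed

lemma ultra_closed_Inter:
  assumes "\<C> \<noteq> {}" "\<And>Z. Z \<in> \<C> \<Longrightarrow> ultra_closed S Z"
  shows "ultra_closed S (\<Inter>\<C>)"
proof -
  obtain \<F> where \<F>: "\<And>Z. Z \<in> \<C> \<Longrightarrow> Z = {p. ultrafilter_on S p \<and> \<F> Z \<subseteq> p}"
    using assms(2) unfolding ultra_closed_def by metis
  have "\<Inter>\<C> = {p. ultrafilter_on S p \<and> (\<Union>Z\<in>\<C>. \<F> Z) \<subseteq> p}"
  proof (intro Set.set_eqI iffI)
    fix p assume "p \<in> \<Inter>\<C>"
    then have "ultrafilter_on S p \<and> \<F> Z \<subseteq> p" if "Z \<in> \<C>" for Z
      using \<F>[OF that] that by blast
    then show "p \<in> {p. ultrafilter_on S p \<and> (\<Union>Z\<in>\<C>. \<F> Z) \<subseteq> p}" using assms(1) by blast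
  next
    fix p assume "p \<in> {p. ultrafilter_on S p \<and> (\<Union>Z\<in>\<C>. \<F> Z) \<subseteq> p}"
    then have "p \<in> Z" if "Z \<in> \<C>" for Z
      using that by (subst \<F>[OF that]) blast
    then show "p \<in> \<Inter>\<C>" by blast
  qed
  then show ?thesis using ultra_closedI by metis
qed

text \<open>Compactness: the filters \<open>\<Inter>Z\<close> form a chain too, so finitely many
  sets from their union already lie in one of them. The union therefore extends to an ultrafilter,
  which belongs to every \<open>Z\<close>.\<close>

lemma ultra_closed_chain_nonempty:
  assumes "\<C> \<noteq> {}" and closed: "\<And>Z. Z \<in> \<C> \<Longrightarrow> ultra_closed S Z \<and> Z \<noteq> {}"
    and chain: "\<And>Y Z. Y \<in> \<C> \<Longrightarrow> Z \<in> \<C> \<Longrightarrow> Y \<subseteq> Z \<or> Z \<subseteq> Y"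
  shows "\<Inter>\<C> \<noteq> {}"
proof -
  define \<F> where "\<F> = (\<Union>Z\<in>\<C>. \<Inter>Z)"
  have ex: "\<exists>p. ultrafilter_on S p \<and> p \<in> Z" if "Z \<in> \<C>" for Z
    using closed[OF that] ultra_closed_imp_ultrafilter by blast
  have "\<exists>p. ultrafilter_on S p \<and> \<F> \<subseteq> p"
  proof (rule ultrafilter_on_extension)
    show "\<F> \<subseteq> Pow S"
    proof
      fix B assume "B \<in> \<F>"
      then obtain Z where "Z \<in> \<C>" "B \<in> \<Inter>Z" unfolding \<F>_def by blast
      moreover obtain p where "ultrafilter_on S p" "p \<in> Z" using ex[OF \<open>Z \<in> \<C>\<close>] by blast
      ultimately show "B \<in> Pow S" using ultrafilter_onD(1) by blast
    qed
    fix \<G> assume \<G>: "finite \<G>" "\<G> \<subseteq> \<F>"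
    have ch: "subset.chain UNIV (Inter ` \<C>)"
      unfolding subset_chain_def using chain by blast
    have sub: "\<G> \<subseteq> \<Union>(Inter ` \<C>)" and ne: "Inter ` \<C> \<noteq> {}"
      using \<G>(2) assms(1) unfolding \<F>_def by simp_all
    obtain \<H> where "\<H> \<in> Inter ` \<C>" "\<G> \<subseteq> \<H>"
      by (rule finite_subset_Union_chain[OF \<G>(1) sub ne ch])
    then obtain Z where Z: "Z \<in> \<C>" "\<G> \<subseteq> \<Inter>Z" by blast
    then obtain p where p: "ultrafilter_on S p" "p \<in> Z" using ex by blast
    then have "S \<inter> \<Inter>\<G> \<in> p" using ultrafilter_on_Inter[OF p(1) \<G>(1)] Z(2) by blast
    then show "S \<inter> \<Inter>\<G> \<noteq> {}" using ultrafilter_onD(3)[OF p(1)] by metis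
  qed
  then obtain p where p: "ultrafilter_on S p" "\<F> \<subseteq> p" by blast
  have "p \<in> Z" if "Z \<in> \<C>" for Z
    using ultra_closed_memI[of S Z p] closed[OF that] p that unfolding \<F>_def by blast
  then show ?thesis by blast
qed

text \<open>\<open>Q\<close> abstracts from the two uses, subsemigroups and left ideals; what they
  share is stability under intersections. Zorn's lemma for inclusion yields maximal sets, so it is
  applied to complements.\<close>

lemma minimal_ultra_closed:
  assumes "ultra_closed S Z\<^sub>0" "Z\<^sub>0 \<noteq> {}" "Q Z\<^sub>0"
    and inter: "\<forall>\<C>. \<C> \<noteq> {} \<longrightarrow> (\<forall>Z\<in>\<C>. Q Z) \<longrightarrow> Q (\<Inter>\<C>)"
  shows "\<exists>Z. ultra_closed S Z \<and> Z \<noteq> {} \<and> Q Z \<and>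
    (\<forall>Y. ultra_closed S Y \<longrightarrow> Y \<noteq> {} \<longrightarrow> Q Y \<longrightarrow> Y \<subseteq> Z \<longrightarrow> Y = Z)"
proof -
  define \<Z> where "\<Z> = {Z. ultra_closed S Z \<and> Z \<noteq> {} \<and> Q Z}"
  have "\<exists>M\<in>uminus ` \<Z>. \<forall>X\<in>uminus ` \<Z>. M \<subseteq> X \<longrightarrow> X = M"
  proof (rule subset_Zorn_nonempty)
    have "Z\<^sub>0 \<in> \<Z>" using assms(1-3) unfolding \<Z>_def by simp
    then show "uminus ` \<Z> \<noteq> {}" by blast
    fix \<C> assume \<C>: "\<C> \<noteq> {}" "subset.chain (uminus ` \<Z>) \<C>"
    define \<D> where "\<D> = uminus ` \<C>"
    have ne: "\<D> \<noteq> {}" using \<C>(1) unfolding \<D>_def by simp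
    have compl: "\<exists>W\<in>\<C>. Z = - W" if "Z \<in> \<D>" for Z using that unfolding \<D>_def by blast
    have sub: "\<D> \<subseteq> \<Z>"
    proof
      fix Z assume "Z \<in> \<D>"
      then obtain W where "W \<in> \<C>" "Z = - W" using compl by blast
      moreover have "\<C> \<subseteq> uminus ` \<Z>" using \<C>(2) by (simp add: subset_chain_def)
      ultimately show "Z \<in> \<Z>" by auto
    qed
    have chain: "Y \<subseteq> Z \<or> Z \<subseteq> Y" if YZ: "Y \<in> \<D>" "Z \<in> \<D>" for Y Z
    proof -
      obtain V W where VW: "V \<in> \<C>" "Y = - V" "W \<in> \<C>" "Z = - W" using compl YZ by meson
      then have "V \<subseteq> W \<or> W \<subseteq> V" using \<C>(2) by (simp add: subset_chain_def)
      then show ?thesis using VW(2,4) by blast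
    qed
    have cl: "ultra_closed S Z" "Z \<noteq> {}" "Q Z" if "Z \<in> \<D>" for Z
      using subsetD[OF sub that] unfolding \<Z>_def by simp_all
    have "ultra_closed S (\<Inter>\<D>)" by (rule ultra_closed_Inter[OF ne cl(1)])
    moreover have "\<Inter>\<D> \<noteq> {}"
      by (rule ultra_closed_chain_nonempty[OF ne]) (use cl chain in simp_all)
    moreover have "Q (\<Inter>\<D>)" using ne cl(3) inter by simp
    ultimately have "\<Inter>\<D> \<in> \<Z>" unfolding \<Z>_def by simp
    moreover have "\<Union>\<C> = - \<Inter>\<D>" unfolding \<D>_def by auto
    ultimately show "\<Union>\<C> \<in> uminus ` \<Z>" by blast
  qed
  then obtain M where M: "M \<in> uminus ` \<Z>" "\<forall>X\<in>uminus ` \<Z>. M \<subseteq> X \<longrightarrow> X = M" by meson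
  then obtain Z where Z: "Z \<in> \<Z>" "M = - Z" by auto
  have "Y = Z" if Y: "ultra_closed S Y" "Y \<noteq> {}" "Q Y" "Y \<subseteq> Z" for Y
  proof -
    have "Y \<in> \<Z>" using Y unfolding \<Z>_def by simp
    then show ?thesis using M(2) Z(2) Y(4) by simp
  qed
  then show ?thesis using Z(1) unfolding \<Z>_def by auto
qed

subsection \<open>The right topological semigroup of ultrafilters\<close>

locale additive_set =
  fixes T :: "'a::semigroup_add set"
  assumes add_closed: "x \<in> T \<Longrightarrow> y \<in> T \<Longrightarrow> x + y \<in> T"
begin

abbreviation uplus (infixl "\<oplus>\<^sub>u" 65) where "p \<oplus>\<^sub>u q \<equiv> ultrafilter_plus T p q"

text \<open>The Boolean homomorphism dual to right translation by \<open>q\<close>: preimages under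
  translation become \<open>shift q\<close>. Its Boolean laws make sums ultrafilters and right
  translations continuous.\<close>

definition shift :: "'a set set \<Rightarrow> 'a set \<Rightarrow> 'a set" where
  "shift q B = {x\<in>T. {y\<in>T. x + y \<in> B} \<in> q}"

lemma mem_uplus: "B \<in> p \<oplus>\<^sub>u q \<longleftrightarrow> B \<subseteq> T \<and> shift q B \<in> p"
  unfolding ultrafilter_plus_def shift_def by blast

lemma shift_subset: "shift q B \<subseteq> T"
  unfolding shift_def by blast

lemma shift_mono:
  assumes "ultrafilter_on T q" "A \<subseteq> B"
  shows "shift q A \<subseteq> shift q B"
proof
  fix x assume x: "x \<in> shift q A"
  have "{y\<in>T. x + y \<in> A} \<subseteq> {y\<in>T. x + y \<in> B}" using assms(2) by blast
  then show "x \<in> shift q B"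
    using x ultrafilter_onD(5)[OF assms(1)] unfolding shift_def by blast
qed

lemma shift_Int:
  assumes "ultrafilter_on T q"
  shows "shift q (A \<inter> B) = shift q A \<inter> shift q B"
proof
  show "shift q (A \<inter> B) \<subseteq> shift q A \<inter> shift q B" using shift_mono[OF assms] by simp
  have "{y\<in>T. x + y \<in> A \<inter> B} = {y\<in>T. x + y \<in> A} \<inter> {y\<in>T. x + y \<in> B}" for x by blast
  then show "shift q A \<inter> shift q B \<subseteq> shift q (A \<inter> B)"
    using ultrafilter_onD(4)[OF assms] unfolding shift_def by auto
qed

lemma shift_compl:
  assumes "ultrafilter_on T q"
  shows "shift q (T - B) = T - shift q B"
proof -
  have "{y\<in>T. x + y \<in> T - B} = T - {y\<in>T. x + y \<in> B}" if "x \<in> T" for x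
    using add_closed[OF that] by auto
  then have "x \<in> shift q (T - B) \<longleftrightarrow> x \<notin> shift q B" if "x \<in> T" for x
    using that ultrafilter_on_compl[OF assms, of "{y\<in>T. x + y \<in> B}"] unfolding shift_def by auto
  then show ?thesis using shift_subset by blast
qed

lemma shift_T:
  assumes "ultrafilter_on T q"
  shows "shift q T = T"
proof -
  have "{y\<in>T. x + y \<in> T} = T" if "x \<in> T" for x using add_closed[OF that] by blast
  then show ?thesis using ultrafilter_onD(2)[OF assms] unfolding shift_def by auto
qed

lemma ultrafilter_uplus:
  assumes "ultrafilter_on T p" "ultrafilter_on T q"
  shows "ultrafilter_on T (p \<oplus>\<^sub>u q)"
  unfolding ultrafilter_on_def
proof (intro conjI ballI allI impI)
  note D = ultrafilter_onD[OF assms(1)]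
  show "T \<in> p \<oplus>\<^sub>u q" using shift_T[OF assms(2)] D by (simp add: mem_uplus)
  have "shift q {} = {}" using ultrafilter_onD(3)[OF assms(2)] unfolding shift_def by simp
  then show "{} \<notin> p \<oplus>\<^sub>u q" using D by (simp add: mem_uplus)
  show "A \<inter> B \<in> p \<oplus>\<^sub>u q" if "A \<in> p \<oplus>\<^sub>u q" "B \<in> p \<oplus>\<^sub>u q" for A B
    using that D shift_Int[OF assms(2)] by (auto simp: mem_uplus)
  show "B \<in> p \<oplus>\<^sub>u q" if "A \<in> p \<oplus>\<^sub>u q" "A \<subseteq> B \<and> B \<subseteq> T" for A B
    using that D(5)[OF _ shift_mono[OF assms(2)] shift_subset] by (auto simp: mem_uplus)
  show "A \<in> p \<oplus>\<^sub>u q \<or> T - A \<in> p \<oplus>\<^sub>u q" if "A \<subseteq> T" for A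
    using that D(6)[OF shift_subset[of q A]] shift_compl[OF assms(2)] by (auto simp: mem_uplus)
qed (auto simp: mem_uplus)

text \<open>Dual to the composition of right translations: shifting by \<open>r\<close> and then by
  \<open>q\<close> is shifting by their sum.\<close>

lemma uplus_assoc:
  assumes "ultrafilter_on T p" "ultrafilter_on T q" "ultrafilter_on T r"
  shows "p \<oplus>\<^sub>u q \<oplus>\<^sub>u r = p \<oplus>\<^sub>u (q \<oplus>\<^sub>u r)"
proof -
  have "shift q (shift r B) = shift (q \<oplus>\<^sub>u r) B" for B
  proof -
    have "{y\<in>T. x + y \<in> B} \<in> q \<oplus>\<^sub>u r \<longleftrightarrow> {y\<in>T. x + y \<in> shift r B} \<in> q" if x: "x \<in> T" for x
    proof -
      have "{z\<in>T. y + z \<in> {y\<in>T. x + y \<in> B}} = {z\<in>T. x + y + z \<in> B}" if "y \<in> T" for y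
        using add_closed[OF that] by (auto simp: add.assoc)
      then have "shift r {y\<in>T. x + y \<in> B} = {y\<in>T. x + y \<in> shift r B}"
        using add_closed[OF x] unfolding shift_def by auto
      then show ?thesis by (auto simp: mem_uplus)
    qed
    then show ?thesis unfolding shift_def[of q] shift_def[of "q \<oplus>\<^sub>u r"] by blast
  qed
  then show ?thesis using shift_subset by (auto simp: mem_uplus)
qed

text \<open>A continuous image of a compact set is closed. The filter of the image consists of the
  sets whose shift belongs to every member of \<open>Z\<close>.\<close>

lemma ultra_closed_translate:
  assumes "ultra_closed T Z" and q: "ultrafilter_on T q"
  shows "ultra_closed T ((\<lambda>p. p \<oplus>\<^sub>u q) ` Z)"
proof -
  obtain \<F> where \<F>: "Z = {p. ultrafilter_on T p \<and> \<F> \<subseteq> p}"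
    using assms(1) unfolding ultra_closed_def by blast
  define \<G> where "\<G> = {B. B \<subseteq> T \<and> (\<forall>p\<in>Z. shift q B \<in> p)}"
  have "r \<in> (\<lambda>p. p \<oplus>\<^sub>u q) ` Z" if r: "ultrafilter_on T r" "\<G> \<subseteq> r" for r
  proof -
    have "\<exists>p. ultrafilter_on T p \<and> (\<F> \<inter> Pow T) \<union> shift q ` r \<subseteq> p"
    proof (rule ultrafilter_on_extension)
      show "(\<F> \<inter> Pow T) \<union> shift q ` r \<subseteq> Pow T" using shift_subset by blast
      fix \<H> assume \<H>: "finite \<H>" "\<H> \<subseteq> (\<F> \<inter> Pow T) \<union> shift q ` r"
      have "\<H> - (\<F> \<inter> Pow T) \<subseteq> shift q ` r" using \<H>(2) by blast
      then obtain \<K> where "finite \<K>" "\<K> \<subseteq> r" "\<H> - (\<F> \<inter> Pow T) = shift q ` \<K>"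
        using finite_subset_image[OF finite_Diff[OF \<H>(1)]] by meson
      then have \<K>: "finite \<K>" "\<K> \<subseteq> r" "\<H> \<subseteq> (\<F> \<inter> Pow T) \<union> shift q ` \<K>"
        by blast+
      define B where "B = T \<inter> \<Inter>\<K>"
      have B: "B \<in> r" using ultrafilter_on_Inter[OF r(1) \<K>(1,2)] unfolding B_def .
      \<comment> \<open>This yields a member of \<open>Z\<close> that contains
        \<open>shift q B\<close>, hence all the shifts occurring in \<open>\<H>\<close> as well as
        \<open>\<F>\<close>: the required finite intersection property.\<close>
      then have "T - B \<notin> \<G>"
        using r(2) ultrafilter_on_compl[OF r(1) ultrafilter_onD(1)[OF r(1) B]] by auto
      then obtain p where p: "p \<in> Z" "shift q (T - B) \<notin> p" unfolding \<G>_def by auto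
      have up: "ultrafilter_on T p" "\<F> \<subseteq> p" using p(1) \<F> by simp_all
      have Bp: "shift q B \<in> p"
        using p(2) ultrafilter_on_compl[OF up(1) shift_subset, of q B] by (simp add: shift_compl[OF q])
      have "shift q K \<in> p" if "K \<in> \<K>" for K
        by (rule ultrafilter_onD(5)[OF up(1) Bp shift_mono[OF q] shift_subset])
          (use that in \<open>auto simp: B_def\<close>)
      then have "\<H> \<subseteq> p" using \<K>(3) up(2) by blast
      then have "T \<inter> \<Inter>\<H> \<in> p" using ultrafilter_on_Inter[OF up(1) \<H>(1)] by blast
      then show "T \<inter> \<Inter>\<H> \<noteq> {}" using ultrafilter_onD(3)[OF up(1)] by metis
    qed
    then obtain p where p: "ultrafilter_on T p" "\<F> \<inter> Pow T \<subseteq> p" "shift q ` r \<subseteq> p" by blast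
    \<comment> \<open>So \<open>Z\<close> is nonempty. Only now is \<open>\<F>\<close> known to
      consist of subsets of \<open>T\<close>, which removes the intersection with
      \<open>Pow T\<close>.\<close>
    have "{} \<notin> \<G>" using r(2) ultrafilter_onD(3)[OF r(1)] by auto
    then obtain w where "ultrafilter_on T w" "\<F> \<subseteq> w" unfolding \<G>_def \<F> by auto
    then have "\<F> \<subseteq> Pow T" using ultrafilter_onD(1) by (meson PowI subsetD subsetI)
    then have "p \<in> Z" using p unfolding \<F> by (simp add: Int_absorb2)
    moreover have "r \<subseteq> p \<oplus>\<^sub>u q"
      using p(3) ultrafilter_onD(1)[OF r(1)] by (auto simp: mem_uplus)
    then have "r = p \<oplus>\<^sub>u q"
      by (rule ultrafilter_on_eqI[OF r(1) ultrafilter_uplus[OF p(1) q]])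
    ultimately show ?thesis by simp
  qed
  moreover have "ultrafilter_on T (p \<oplus>\<^sub>u q) \<and> \<G> \<subseteq> p \<oplus>\<^sub>u q" if "p \<in> Z" for p
  proof
    show "ultrafilter_on T (p \<oplus>\<^sub>u q)" using that \<F> by (intro ultrafilter_uplus q) simp
    show "\<G> \<subseteq> p \<oplus>\<^sub>u q" using that by (auto simp: mem_uplus \<G>_def)
  qed
  ultimately have "(\<lambda>p. p \<oplus>\<^sub>u q) ` Z = {r. ultrafilter_on T r \<and> \<G> \<subseteq> r}"
    by (intro antisym subsetI) auto
  then show ?thesis by (simp add: ultra_closedI)
qed

text \<open>A fibre of a continuous map. By maximality of ultrafilters the equation holds as soon as
  \<open>p\<close> contains \<open>shift q B\<close> for every \<open>B\<close> in \<open>r\<close>,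
  and this is a closed condition on \<open>p\<close>.\<close>

lemma ultra_closed_stabilizer:
  assumes "ultra_closed T Z" "ultrafilter_on T q" "ultrafilter_on T r"
  shows "ultra_closed T {p\<in>Z. p \<oplus>\<^sub>u q = r}"
proof -
  have "p \<oplus>\<^sub>u q = r \<longleftrightarrow> shift q ` r \<subseteq> p" if p: "ultrafilter_on T p" for p
  proof
    assume "p \<oplus>\<^sub>u q = r"
    then show "shift q ` r \<subseteq> p" by (auto simp: mem_uplus)
  next
    assume "shift q ` r \<subseteq> p"
    then have "r \<subseteq> p \<oplus>\<^sub>u q" using ultrafilter_onD(1)[OF assms(3)] by (auto simp: mem_uplus)
    then show "p \<oplus>\<^sub>u q = r"
      using ultrafilter_on_eqI[OF assms(3) ultrafilter_uplus[OF p assms(2)]] by simp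
  qed
  then have "{p\<in>Z. p \<oplus>\<^sub>u q = r} = Z \<inter> {p. ultrafilter_on T p \<and> shift q ` r \<subseteq> p}"
    using ultra_closed_imp_ultrafilter[OF assms(1)] by auto
  then show ?thesis by (simp add: ultra_closed_Int[OF assms(1) ultra_closedI])
qed

text \<open>Ellis: in a minimal closed subsemigroup \<open>Z\<close>, both \<open>Z + e\<close> and the stabilizer of \<open>e\<close> are
  closed subsemigroups, hence everything.\<close>

lemma idempotent_in_closed_subsemigroup:
  assumes "ultra_closed T Z\<^sub>0" "Z\<^sub>0 \<noteq> {}" "\<And>p q. p \<in> Z\<^sub>0 \<Longrightarrow> q \<in> Z\<^sub>0 \<Longrightarrow> p \<oplus>\<^sub>u q \<in> Z\<^sub>0"
  shows "\<exists>e\<in>Z\<^sub>0. e \<oplus>\<^sub>u e = e"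
proof -
  define Q where "Q Z \<longleftrightarrow> Z \<subseteq> Z\<^sub>0 \<and> (\<forall>p\<in>Z. \<forall>q\<in>Z. p \<oplus>\<^sub>u q \<in> Z)" for Z
  have "Q Z\<^sub>0" using assms(3) unfolding Q_def by blast
  moreover have "\<forall>\<C>. \<C> \<noteq> {} \<longrightarrow> (\<forall>Z\<in>\<C>. Q Z) \<longrightarrow> Q (\<Inter>\<C>)"
    unfolding Q_def by (simp add: Inf_less_eq)
  ultimately have "\<exists>Z. ultra_closed T Z \<and> Z \<noteq> {} \<and> Q Z \<and>
    (\<forall>Y. ultra_closed T Y \<longrightarrow> Y \<noteq> {} \<longrightarrow> Q Y \<longrightarrow> Y \<subseteq> Z \<longrightarrow> Y = Z)"
    using minimal_ultra_closed[where Q = Q, OF assms(1,2)] by simp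
  then obtain Z where Z: "ultra_closed T Z" "Z \<noteq> {}" "Q Z"
    and min: "\<And>Y. ultra_closed T Y \<Longrightarrow> Y \<noteq> {} \<Longrightarrow> Q Y \<Longrightarrow> Y \<subseteq> Z \<Longrightarrow> Y = Z"
    by auto
  have ult: "ultrafilter_on T p" if "p \<in> Z" for p
    using ultra_closed_imp_ultrafilter[OF Z(1) that] .
  have sub: "Z \<subseteq> Z\<^sub>0" and sg: "\<And>p q. p \<in> Z \<Longrightarrow> q \<in> Z \<Longrightarrow> p \<oplus>\<^sub>u q \<in> Z"
    using Z(3) unfolding Q_def by simp_all
  obtain e where e: "e \<in> Z" using Z(2) by blast
  let ?Ze = "(\<lambda>p. p \<oplus>\<^sub>u e) ` Z"
  have "p \<oplus>\<^sub>u e \<oplus>\<^sub>u (q \<oplus>\<^sub>u e) \<in> ?Ze" if pq: "p \<in> Z" "q \<in> Z" for p q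
  proof -
    have "p \<oplus>\<^sub>u e \<oplus>\<^sub>u (q \<oplus>\<^sub>u e) = p \<oplus>\<^sub>u e \<oplus>\<^sub>u q \<oplus>\<^sub>u e"
      by (rule uplus_assoc[OF ult[OF sg[OF pq(1) e]] ult[OF pq(2)] ult[OF e], symmetric])
    then show ?thesis using sg[OF sg[OF pq(1) e] pq(2)] by simp
  qed
  then have "Q ?Ze" using sub sg[OF _ e] unfolding Q_def by auto
  moreover have "?Ze \<subseteq> Z" using sg[OF _ e] by auto
  ultimately have "?Ze = Z"
    using min[OF ultra_closed_translate[OF Z(1) ult[OF e]]] Z(2) by simp
  then have "e \<in> ?Ze" using e by simp
  then obtain x where x: "x \<in> Z" "x \<oplus>\<^sub>u e = e" by auto
  let ?St = "{p\<in>Z. p \<oplus>\<^sub>u e = e}"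
  have "p \<oplus>\<^sub>u q \<oplus>\<^sub>u e = e" if "p \<in> ?St" "q \<in> ?St" for p q
    using that uplus_assoc[OF ult ult ult[OF e], of p q] by simp
  then have "Q ?St" using sub sg unfolding Q_def by auto
  then have "?St = Z"
    using min[OF ultra_closed_stabilizer[OF Z(1) ult[OF e] ult[OF e]]] x by auto
  then have "e \<oplus>\<^sub>u e = e" using e by auto
  then show ?thesis using e sub by blast
qed

end

subsection \<open>Minimal left ideals\<close>

definition left_ideal :: "'b set \<Rightarrow> ('b \<Rightarrow> 'b \<Rightarrow> 'b) \<Rightarrow> 'b set \<Rightarrow> bool" where
  "left_ideal H f L \<longleftrightarrow> L \<subseteq> H \<and> L \<noteq> {} \<and> (\<forall>t\<in>H. \<forall>x\<in>L. f t x \<in> L)"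

definition minimal_left_ideal :: "'b set \<Rightarrow> ('b \<Rightarrow> 'b \<Rightarrow> 'b) \<Rightarrow> 'b set \<Rightarrow> bool" where
  "minimal_left_ideal H f L \<longleftrightarrow>
     left_ideal H f L \<and> (\<forall>L'. left_ideal H f L' \<longrightarrow> L' \<subseteq> L \<longrightarrow> L' = L)"

locale semigroup_on =
  fixes H :: "'b set" and f :: "'b \<Rightarrow> 'b \<Rightarrow> 'b"
  assumes closed: "x \<in> H \<Longrightarrow> y \<in> H \<Longrightarrow> f x y \<in> H"
    and assoc: "x \<in> H \<Longrightarrow> y \<in> H \<Longrightarrow> z \<in> H \<Longrightarrow> f (f x y) z = f x (f y z)"
begin

lemma left_ideal_translate:
  assumes "left_ideal H f L" "t \<in> H"
  shows "left_ideal H f ((\<lambda>x. f x t) ` L)"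
  unfolding left_ideal_def
proof (intro conjI ballI)
  have L: "L \<subseteq> H" "L \<noteq> {}" "\<forall>t\<in>H. \<forall>x\<in>L. f t x \<in> L"
    using assms(1) unfolding left_ideal_def by simp_all
  show "(\<lambda>x. f x t) ` L \<subseteq> H" using L(1) closed[OF _ assms(2)] by auto
  show "(\<lambda>x. f x t) ` L \<noteq> {}" using L(2) by simp
  fix s y assume s: "s \<in> H" and "y \<in> (\<lambda>x. f x t) ` L"
  then obtain x where x: "x \<in> L" "y = f x t" by auto
  then have "f s y = f (f s x) t" using assoc[OF s _ assms(2)] L(1) by auto
  then show "f s y \<in> (\<lambda>x. f x t) ` L" using L(3) s x(1) by auto
qed

text \<open>A left ideal inside the translate pulls back to a left ideal inside \<open>L\<close>,
  hence to all of \<open>L\<close>.\<close>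

lemma minimal_left_ideal_translate:
  assumes "minimal_left_ideal H f L" "t \<in> H"
  shows "minimal_left_ideal H f ((\<lambda>x. f x t) ` L)"
  unfolding minimal_left_ideal_def
proof (intro conjI allI impI)
  have L: "left_ideal H f L" and min: "\<And>L'. left_ideal H f L' \<Longrightarrow> L' \<subseteq> L \<Longrightarrow> L' = L"
    using assms(1) unfolding minimal_left_ideal_def by simp_all
  have LH: "L \<subseteq> H" and Lcl: "\<forall>t\<in>H. \<forall>x\<in>L. f t x \<in> L" using L unfolding left_ideal_def by simp_all
  show "left_ideal H f ((\<lambda>x. f x t) ` L)" by (rule left_ideal_translate[OF L assms(2)])
  fix L' assume L': "left_ideal H f L'" "L' \<subseteq> (\<lambda>x. f x t) ` L"
  then have L'cl: "\<forall>t\<in>H. \<forall>x\<in>L'. f t x \<in> L'" "L' \<noteq> {}" unfolding left_ideal_def by simp_all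
  have "left_ideal H f {x\<in>L. f x t \<in> L'}"
    unfolding left_ideal_def
  proof (intro conjI ballI)
    show "{x\<in>L. f x t \<in> L'} \<subseteq> H" using LH by auto
    obtain y where "y \<in> L'" using L'cl(2) by auto
    then show "{x\<in>L. f x t \<in> L'} \<noteq> {}" using L'(2) by auto
    fix s x assume s: "s \<in> H" and x: "x \<in> {x\<in>L. f x t \<in> L'}"
    then have "f (f s x) t = f s (f x t)" using assoc[OF s _ assms(2)] LH by auto
    then show "f s x \<in> {x\<in>L. f x t \<in> L'}" using s x Lcl L'cl(1) by simp
  qed
  then have "{x\<in>L. f x t \<in> L'} = L" by (rule min) auto
  then show "L' = (\<lambda>x. f x t) ` L" using L'(2) by auto
qed

text \<open>Products of an element of \<open>I\<close> with one of \<open>L\<close> lie in both, so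
  the intersection is a left ideal inside \<open>L\<close>.\<close>

lemma minimal_left_ideal_subset_ideal:
  assumes "minimal_left_ideal H f L" "two_sided_ideal H f I"
  shows "L \<subseteq> I"
proof -
  have L: "left_ideal H f L" and min: "\<And>L'. left_ideal H f L' \<Longrightarrow> L' \<subseteq> L \<Longrightarrow> L' = L"
    using assms(1) unfolding minimal_left_ideal_def by simp_all
  have LH: "L \<subseteq> H" "L \<noteq> {}" and Lcl: "\<forall>t\<in>H. \<forall>x\<in>L. f t x \<in> L"
    using L unfolding left_ideal_def by simp_all
  have I: "I \<subseteq> H" "I \<noteq> {}" "\<forall>t\<in>H. \<forall>x\<in>I. f t x \<in> I \<and> f x t \<in> I"
    using assms(2) unfolding two_sided_ideal_def by simp_all
  obtain i x where "i \<in> I" "x \<in> L" using I(2) LH(2) by auto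
  then have "f i x \<in> I \<inter> L" using I LH Lcl by auto
  then have "left_ideal H f (I \<inter> L)" using LH Lcl I unfolding left_ideal_def by auto
  then have "I \<inter> L = L" by (rule min) auto
  then show ?thesis by auto
qed

lemma minimal_left_ideal_subset_smallest:
  "minimal_left_ideal H f L \<Longrightarrow> L \<subseteq> smallest_ideal H f"
  using minimal_left_ideal_subset_ideal unfolding smallest_ideal_def by auto

text \<open>The union of all minimal left ideals is a two-sided ideal, because right translates of
  minimal left ideals are again minimal. \<open>L\<^sub>0\<close> makes this union nonempty.\<close>

lemma smallest_ideal_imp_minimal_left_ideal:
  assumes "p \<in> smallest_ideal H f" "minimal_left_ideal H f L\<^sub>0"
  shows "\<exists>L. minimal_left_ideal H f L \<and> p \<in> L"
proof -
  let ?U = "\<Union>{L. minimal_left_ideal H f L}"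
  have sub: "L \<subseteq> H" "L \<noteq> {}" "\<forall>t\<in>H. \<forall>x\<in>L. f t x \<in> L" if "minimal_left_ideal H f L" for L
    using that unfolding minimal_left_ideal_def left_ideal_def by simp_all
  have "two_sided_ideal H f ?U"
    unfolding two_sided_ideal_def
  proof (intro conjI ballI)
    show "?U \<subseteq> H" using sub(1) by auto
    show "?U \<noteq> {}" using assms(2) sub(2)[OF assms(2)] by auto
    fix t x assume t: "t \<in> H" and "x \<in> ?U"
    then obtain L where L: "minimal_left_ideal H f L" "x \<in> L" by auto
    then show "f t x \<in> ?U" using sub(3)[OF L(1)] t by auto
    have "f x t \<in> (\<lambda>x. f x t) ` L" using L(2) by simp
    then show "f x t \<in> ?U" using minimal_left_ideal_translate[OF L(1) t] by auto
  qed
  then have "p \<in> ?U" using assms(1) unfolding smallest_ideal_def by auto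
  then show ?thesis by auto
qed

text \<open>By minimality \<open>L\<close> consists of the products \<open>f s e\<close>, so
  \<open>p\<close> is one of them, and the idempotent \<open>e\<close> is a right identity for
  these.\<close>

lemma minimal_left_ideal_absorb:
  assumes "minimal_left_ideal H f L" "p \<in> L" "r \<in> H" "e = f r p" "f e e = e"
  shows "f p e = p"
proof -
  have L: "left_ideal H f L" and min: "\<And>L'. left_ideal H f L' \<Longrightarrow> L' \<subseteq> L \<Longrightarrow> L' = L"
    using assms(1) unfolding minimal_left_ideal_def by simp_all
  have LH: "L \<subseteq> H" and Lcl: "\<forall>t\<in>H. \<forall>x\<in>L. f t x \<in> L" using L unfolding left_ideal_def by simp_all
  have e: "e \<in> L" using assms(2-4) Lcl by simp
  then have eH: "e \<in> H" using LH by auto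
  have "left_ideal H f H" using closed eH unfolding left_ideal_def by auto
  then have "(\<lambda>x. f x e) ` H = L"
    using e Lcl by (intro min left_ideal_translate eH) auto
  then obtain s where "s \<in> H" "p = f s e" using assms(2) by auto
  then show ?thesis using assoc[OF _ eH eH] assms(5) by simp
qed

end

context additive_set
begin

text \<open>Zorn's lemma gives minimality among closed left ideals. It extends to all left ideals,
  since each of them contains the translate of \<open>H\<close> by one of its points, which is a
  closed left ideal.\<close>

lemma minimal_left_ideal_exists:
  assumes "ultra_closed T H" "H \<noteq> {}" "\<And>p q. p \<in> H \<Longrightarrow> q \<in> H \<Longrightarrow> p \<oplus>\<^sub>u q \<in> H"
  shows "\<exists>L. minimal_left_ideal H (ultrafilter_plus T) L \<and> ultra_closed T L"
proof -
  define Q where "Q Z \<longleftrightarrow> Z \<subseteq> H \<and> (\<forall>t\<in>H. \<forall>x\<in>Z. t \<oplus>\<^sub>u x \<in> Z)" for Z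
  have ult: "ultrafilter_on T p" if "p \<in> H" for p
    by (rule ultra_closed_imp_ultrafilter[OF assms(1) that])
  interpret H: semigroup_on H "ultrafilter_plus T"
    by unfold_locales (use assms(3) ult in \<open>simp_all add: uplus_assoc\<close>)
  have "Q H" using assms(3) unfolding Q_def by simp
  moreover have "\<forall>\<C>. \<C> \<noteq> {} \<longrightarrow> (\<forall>Z\<in>\<C>. Q Z) \<longrightarrow> Q (\<Inter>\<C>)"
    unfolding Q_def by (simp add: Inf_less_eq)
  ultimately have "\<exists>Z. ultra_closed T Z \<and> Z \<noteq> {} \<and> Q Z \<and>
    (\<forall>Y. ultra_closed T Y \<longrightarrow> Y \<noteq> {} \<longrightarrow> Q Y \<longrightarrow> Y \<subseteq> Z \<longrightarrow> Y = Z)"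
    using minimal_ultra_closed[where Q = Q, OF assms(1,2)] by simp
  then obtain L where L: "ultra_closed T L" "L \<noteq> {}" "Q L"
    and min: "\<And>Y. ultra_closed T Y \<Longrightarrow> Y \<noteq> {} \<Longrightarrow> Q Y \<Longrightarrow> Y \<subseteq> L \<Longrightarrow> Y = L"
    by auto
  have "left_ideal H (ultrafilter_plus T) L"
    using L(2,3) unfolding left_ideal_def Q_def by simp
  moreover have "L' = L" if L': "left_ideal H (ultrafilter_plus T) L'" "L' \<subseteq> L" for L'
  proof -
    have L'cl: "L' \<subseteq> H" "L' \<noteq> {}" "\<forall>t\<in>H. \<forall>x\<in>L'. t \<oplus>\<^sub>u x \<in> L'"
      using L'(1) unfolding left_ideal_def by simp_all
    obtain x where x: "x \<in> L'" using L'cl(2) by auto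
    then have xH: "x \<in> H" using L'cl(1) by auto
    have "left_ideal H (ultrafilter_plus T) H" using assms(2,3) unfolding left_ideal_def by simp
    from H.left_ideal_translate[OF this xH] have "Q ((\<lambda>p. p \<oplus>\<^sub>u x) ` H)"
      unfolding Q_def left_ideal_def by simp
    moreover have sub: "(\<lambda>p. p \<oplus>\<^sub>u x) ` H \<subseteq> L'" using L'cl(3) x by auto
    ultimately have "(\<lambda>p. p \<oplus>\<^sub>u x) ` H = L"
      using min[OF ultra_closed_translate[OF assms(1) ult[OF xH]]] assms(2) L'(2) by simp
    then show ?thesis using sub L'(2) by simp
  qed
  ultimately show ?thesis using L(1) unfolding minimal_left_ideal_def by auto
qed

end

subsection \<open>Ultrafilters near zero\<close>

locale dense_semigroup =
  fixes S :: "real set"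
  assumes pos: "S \<subseteq> {0<..}" and S_add: "x \<in> S \<Longrightarrow> y \<in> S \<Longrightarrow> x + y \<in> S"
    and dense: "{0<..} \<subseteq> closure S"
begin

sublocale additive_set S by unfold_locales (rule S_add)

abbreviation splus (infixl "\<oplus>\<^sub>S" 65) where "p \<oplus>\<^sub>S q \<equiv> ultrafilter_plus S p q"

lemma small_element:
  assumes "0 < \<epsilon>"
  shows "\<exists>s\<in>S. s < \<epsilon>"
proof -
  have "\<epsilon> / 2 \<in> closure S" using dense assms by auto
  then obtain s where "s \<in> S" "dist s (\<epsilon> / 2) < \<epsilon> / 2"
    using assms unfolding closure_approachable by (meson half_gt_zero)
  then have "s < \<epsilon>" unfolding dist_real_def by linarith
  then show ?thesis using \<open>s \<in> S\<close> by auto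
qed

lemma O_plusD: "p \<in> O_plus S \<Longrightarrow> ultrafilter_on S p" "p \<in> O_plus S \<Longrightarrow> 0 < \<epsilon> \<Longrightarrow> {0<..<\<epsilon>} \<inter> S \<in> p"
  unfolding O_plus_def ultrafilters_def by simp_all

lemma O_plus_eq: "O_plus S = {p. ultrafilter_on S p \<and> (\<lambda>\<epsilon>. {0<..<\<epsilon>} \<inter> S) ` {0<..} \<subseteq> p}"
  unfolding O_plus_def ultrafilters_def by auto

lemma O_plus_closed: "ultra_closed S (O_plus S)"
  unfolding O_plus_eq by (rule ultra_closedI)

lemma O_plus_nonempty: "O_plus S \<noteq> {}"
proof -
  have "\<exists>p. ultrafilter_on S p \<and> (\<lambda>\<epsilon>. {0<..<\<epsilon>} \<inter> S) ` {0<..} \<subseteq> p"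
  proof (rule ultrafilter_on_extension)
    fix \<G> assume \<G>: "finite \<G>" "\<G> \<subseteq> (\<lambda>\<epsilon>. {0<..<\<epsilon>} \<inter> S) ` {0<..}"
    obtain E where E: "finite E" "E \<subseteq> {0<..}" "\<G> = (\<lambda>\<epsilon>. {0<..<\<epsilon>} \<inter> S) ` E"
      using finite_subset_image[OF \<G>] by blast
    have "0 < Min (insert 1 E)" using E(1,2) by auto
    then obtain s where s: "s \<in> S" "s < Min (insert 1 E)" using small_element by meson
    then have "s \<in> S \<inter> \<Inter>\<G>" using E(1) pos unfolding E(3) by auto
    then show "S \<inter> \<Inter>\<G> \<noteq> {}" by auto
  qed auto
  then show ?thesis unfolding O_plus_eq by auto
qed

lemma O_plus_add:
  assumes "p \<in> O_plus S" "q \<in> O_plus S"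
  shows "p \<oplus>\<^sub>S q \<in> O_plus S"
proof -
  note p = O_plusD[OF assms(1)] and q = O_plusD[OF assms(2)]
  have "{0<..<\<epsilon>} \<inter> S \<in> p \<oplus>\<^sub>S q" if "0 < \<epsilon>" for \<epsilon>
  proof -
    have "x \<in> shift q ({0<..<\<epsilon>} \<inter> S)" if x: "x \<in> {0<..<\<epsilon>} \<inter> S" for x
    proof -
      \<comment> \<open>The room left by \<open>x\<close>: it depends on \<open>x\<close>, but is
        positive for each.\<close>
      have "{0<..<\<epsilon> - x} \<inter> S \<in> q" using x by (intro q(2)) auto
      then have "{y\<in>S. x + y \<in> {0<..<\<epsilon>} \<inter> S} \<in> q"
        using x S_add by (elim ultrafilter_onD(5)[OF q(1)]) auto
      then show ?thesis using x unfolding shift_def by simp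
    qed
    then have "shift q ({0<..<\<epsilon>} \<inter> S) \<in> p"
      by (intro ultrafilter_onD(5)[OF p(1) p(2)[OF that] _ shift_subset]) auto
    then show ?thesis by (simp add: mem_uplus)
  qed
  then show ?thesis
    using ultrafilter_uplus[OF p(1) q(1)] unfolding O_plus_def ultrafilters_def by simp
qed

sublocale O_plus: semigroup_on "O_plus S" "ultrafilter_plus S"
  by unfold_locales (use O_plus_add O_plusD(1) in \<open>simp_all add: uplus_assoc\<close>)

text \<open>The implication from central sets to the integers starts from a central ultrafilter, so
  one has to exist.\<close>

lemma minimal_idempotent_exists: "minimal_idempotents_near_zero S \<noteq> {}"
proof -
  obtain L where L: "minimal_left_ideal (O_plus S) (ultrafilter_plus S) L" "ultra_closed S L"
    using minimal_left_ideal_exists[OF O_plus_closed O_plus_nonempty O_plus_add] by auto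
  have L': "L \<subseteq> O_plus S" "L \<noteq> {}" "\<forall>t\<in>O_plus S. \<forall>x\<in>L. t \<oplus>\<^sub>S x \<in> L"
    using L(1) unfolding minimal_left_ideal_def left_ideal_def by simp_all
  have "\<exists>e\<in>L. e \<oplus>\<^sub>S e = e"
    by (rule idempotent_in_closed_subsemigroup[OF L(2) L'(2)]) (use L' in auto)
  then show ?thesis
    using O_plus.minimal_left_ideal_subset_smallest[OF L(1)]
    unfolding minimal_idempotents_near_zero_def by auto
qed

text \<open>The third fact is how membership in the smallest ideal is exploited: idempotents in the
  left ideal of \<open>p\<close> are right identities for \<open>p\<close>.\<close>

lemma minimal_idempotentD:
  assumes "p \<in> minimal_idempotents_near_zero S"
  shows "p \<in> O_plus S" "p \<oplus>\<^sub>S p = p"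
    "\<And>r e. r \<in> O_plus S \<Longrightarrow> e = r \<oplus>\<^sub>S p \<Longrightarrow> e \<oplus>\<^sub>S e = e \<Longrightarrow> p \<oplus>\<^sub>S e = p"
proof -
  have p: "p \<in> smallest_ideal (O_plus S) (ultrafilter_plus S)"
    and idem: "p \<oplus>\<^sub>S p = p"
    using assms unfolding minimal_idempotents_near_zero_def by simp_all
  obtain L\<^sub>0 where "minimal_left_ideal (O_plus S) (ultrafilter_plus S) L\<^sub>0"
    using minimal_left_ideal_exists[OF O_plus_closed O_plus_nonempty O_plus_add] by auto
  then obtain L where L: "minimal_left_ideal (O_plus S) (ultrafilter_plus S) L" "p \<in> L"
    using O_plus.smallest_ideal_imp_minimal_left_ideal[OF p] by auto
  show "p \<in> O_plus S" using L unfolding minimal_left_ideal_def left_ideal_def by auto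
  show "p \<oplus>\<^sub>S p = p" by (rule idem)
  show "p \<oplus>\<^sub>S e = p" if "r \<in> O_plus S" "e = r \<oplus>\<^sub>S p" "e \<oplus>\<^sub>S e = e" for r e
    by (rule O_plus.minimal_left_ideal_absorb[OF L that])
qed

end

subsection \<open>Images of ultrafilters\<close>

lemma ultrafilter_on_cong:
  assumes "ultrafilter_on X p" "A \<in> p" "\<And>x. x \<in> A \<Longrightarrow> P x \<longleftrightarrow> Q x"
  shows "{x\<in>X. P x} \<in> p \<longleftrightarrow> {x\<in>X. Q x} \<in> p"
proof -
  have *: "{x\<in>X. Q x} \<in> p" if "{x\<in>X. P x} \<in> p" "\<And>x. x \<in> A \<Longrightarrow> P x \<Longrightarrow> Q x" for P Q
  proof -
    have "A \<inter> {x\<in>X. P x} \<in> p" by (rule ultrafilter_onD(4)[OF assms(1,2) that(1)])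
    then show ?thesis by (rule ultrafilter_onD(5)[OF assms(1)]) (use that(2) in auto)
  qed
  show ?thesis
  proof
    assume "{x\<in>X. P x} \<in> p" then show "{x\<in>X. Q x} \<in> p" by (rule *) (simp add: assms(3))
  next
    assume "{x\<in>X. Q x} \<in> p" then show "{x\<in>X. P x} \<in> p" by (rule *) (simp add: assms(3))
  qed
qed

text \<open>Push-forward along a map that lands in \<open>Y\<close> merely almost everywhere:
  \<open>axis\<close> leads from \<open>S\<close> into \<open>tuples\<close> only on multiples of
  \<open>d\<close>, and a linear form may take the value 0 outside \<open>S\<close>.\<close>

definition ultrafilter_image :: "'a set \<Rightarrow> 'b set \<Rightarrow> ('a \<Rightarrow> 'b) \<Rightarrow> 'a set set \<Rightarrow> 'b set set" where
  "ultrafilter_image X Y f p = {B. B \<subseteq> Y \<and> {x\<in>X. f x \<in> B} \<in> p}"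

lemma ultrafilter_on_image:
  assumes p: "ultrafilter_on X p" and Y: "{x\<in>X. f x \<in> Y} \<in> p"
  shows "ultrafilter_on Y (ultrafilter_image X Y f p)"
  unfolding ultrafilter_on_def
proof (intro conjI ballI allI impI)
  note D = ultrafilter_onD[OF p]
  show "ultrafilter_image X Y f p \<subseteq> Pow Y" unfolding ultrafilter_image_def by auto
  show "Y \<in> ultrafilter_image X Y f p" using Y unfolding ultrafilter_image_def by simp
  show "{} \<notin> ultrafilter_image X Y f p" using D(3) unfolding ultrafilter_image_def by simp
  show "A \<inter> B \<in> ultrafilter_image X Y f p"
    if "A \<in> ultrafilter_image X Y f p" "B \<in> ultrafilter_image X Y f p" for A B
  proof -
    have "{x\<in>X. f x \<in> A} \<inter> {x\<in>X. f x \<in> B} \<in> p"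
      by (rule D(4)) (use that in \<open>simp_all add: ultrafilter_image_def\<close>)
    moreover have "{x\<in>X. f x \<in> A} \<inter> {x\<in>X. f x \<in> B} = {x\<in>X. f x \<in> A \<inter> B}" by auto
    ultimately show ?thesis using that unfolding ultrafilter_image_def by auto
  qed
  show "B \<in> ultrafilter_image X Y f p"
    if A: "A \<in> ultrafilter_image X Y f p" and AB: "A \<subseteq> B \<and> B \<subseteq> Y" for A B
  proof -
    have "{x\<in>X. f x \<in> A} \<in> p" using A unfolding ultrafilter_image_def by simp
    then have "{x\<in>X. f x \<in> B} \<in> p" by (rule D(5)) (use AB in auto)
    then show ?thesis using AB unfolding ultrafilter_image_def by simp
  qed
  show "A \<in> ultrafilter_image X Y f p \<or> Y - A \<in> ultrafilter_image X Y f p" if "A \<subseteq> Y" for A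
  proof -
    have "{x\<in>X. f x \<in> A} \<in> p \<or> X - {x\<in>X. f x \<in> A} \<in> p" by (rule D(6)) auto
    moreover have "{x\<in>X. f x \<in> Y - A} \<in> p" if "X - {x\<in>X. f x \<in> A} \<in> p"
    proof -
      have "(X - {x\<in>X. f x \<in> A}) \<inter> {x\<in>X. f x \<in> Y} \<in> p" by (rule D(4)[OF that Y])
      then show ?thesis by (rule D(5)) auto
    qed
    ultimately show ?thesis using that unfolding ultrafilter_image_def by auto
  qed
qed

text \<open>Membership in a sum of ultrafilters is tested almost everywhere in each argument, so it
  suffices that \<open>f\<close> is additive on a set \<open>D\<close> belonging to both.\<close>

lemma ultrafilter_image_plus:
  assumes p: "ultrafilter_on X p" and q: "ultrafilter_on X q"
    and D: "D \<in> p" "D \<in> q" "f ` D \<subseteq> Y"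
    and add: "\<And>x y. x \<in> D \<Longrightarrow> y \<in> D \<Longrightarrow> f (x + y) = f x + f y"
    and X: "\<And>x y. x \<in> X \<Longrightarrow> y \<in> X \<Longrightarrow> x + y \<in> X"
  shows "ultrafilter_image X Y f (ultrafilter_plus X p q) =
    ultrafilter_plus Y (ultrafilter_image X Y f p) (ultrafilter_image X Y f q)"
proof -
  have DX: "D \<subseteq> X" by (rule ultrafilter_onD(1)[OF p D(1)])
  have "{x\<in>X. f x \<in> B} \<in> ultrafilter_plus X p q \<longleftrightarrow>
      {y\<in>Y. {z\<in>Y. y + z \<in> B} \<in> ultrafilter_image X Y f q} \<in> ultrafilter_image X Y f p" for B
  proof -
    have 1: "{y\<in>X. x + y \<in> {x\<in>X. f x \<in> B}} \<in> q \<longleftrightarrow>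
        f x \<in> {y\<in>Y. {z\<in>Y. y + z \<in> B} \<in> ultrafilter_image X Y f q}" if x: "x \<in> D" for x
    proof -
      have "{y\<in>X. x + y \<in> {x\<in>X. f x \<in> B}} \<in> q \<longleftrightarrow> {y\<in>X. f y \<in> {z\<in>Y. f x + z \<in> B}} \<in> q"
      proof (rule ultrafilter_on_cong[OF q D(2)])
        fix y assume y: "y \<in> D"
        have "x + y \<in> X" "f y \<in> Y" using X x y DX D(3) by auto
        then show "x + y \<in> {x\<in>X. f x \<in> B} \<longleftrightarrow> f y \<in> {z\<in>Y. f x + z \<in> B}"
          using add[OF x y] by simp
      qed
      then show ?thesis using x D(3) unfolding ultrafilter_image_def by auto
    qed
    have "{x\<in>X. {y\<in>X. x + y \<in> {x\<in>X. f x \<in> B}} \<in> q} \<in> p \<longleftrightarrow>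
      {x\<in>X. f x \<in> {y\<in>Y. {z\<in>Y. y + z \<in> B} \<in> ultrafilter_image X Y f q}} \<in> p"
      by (rule ultrafilter_on_cong[OF p D(1) 1])
    then show ?thesis
      unfolding ultrafilter_plus_def ultrafilter_image_def[of X Y f p] by simp
  qed
  then show ?thesis
    unfolding ultrafilter_plus_def[of Y] ultrafilter_image_def[of X Y f "ultrafilter_plus X p q"] by simp
qed

text \<open>Complements \<open>ultrafilter_image_plus\<close>: for \<open>Y = S\<close>, which omits
  0, the image of \<open>p\<close> is no ultrafilter when \<open>f\<close> vanishes almost
  everywhere. The summand then simply drops out.\<close>

lemma ultrafilter_image_plus_zero_left:
  fixes f :: "'a::plus \<Rightarrow> 'b::monoid_add"
  assumes p: "ultrafilter_on X p" and q: "ultrafilter_on X q"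
    and D: "{x\<in>X. f x = 0} \<in> p"
    and add: "\<And>x y. x \<in> X \<Longrightarrow> y \<in> X \<Longrightarrow> f (x + y) = f x + f y"
    and X: "\<And>x y. x \<in> X \<Longrightarrow> y \<in> X \<Longrightarrow> x + y \<in> X"
  shows "ultrafilter_image X Y f (ultrafilter_plus X p q) = ultrafilter_image X Y f q"
proof -
  have "{x\<in>X. {y\<in>X. x + y \<in> {x\<in>X. f x \<in> B}} \<in> q} \<in> p \<longleftrightarrow> {x\<in>X. {y\<in>X. f y \<in> B} \<in> q} \<in> p" for B
  proof (rule ultrafilter_on_cong[OF p D])
    fix x assume "x \<in> {x\<in>X. f x = 0}"
    then have "{y\<in>X. x + y \<in> {x\<in>X. f x \<in> B}} = {y\<in>X. f y \<in> B}" using add X by auto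
    then show "{y\<in>X. x + y \<in> {x\<in>X. f x \<in> B}} \<in> q \<longleftrightarrow> {y\<in>X. f y \<in> B} \<in> q" by simp
  qed
  moreover have "{x\<in>X. {y\<in>X. f y \<in> B} \<in> q} \<in> p \<longleftrightarrow> {y\<in>X. f y \<in> B} \<in> q" for B
    using ultrafilter_onD(2,3)[OF p] by (cases "{y\<in>X. f y \<in> B} \<in> q") simp_all
  ultimately show ?thesis unfolding ultrafilter_plus_def ultrafilter_image_def by simp
qed

lemma ultrafilter_image_plus_zero_right:
  fixes f :: "'a::plus \<Rightarrow> 'b::monoid_add"
  assumes p: "ultrafilter_on X p" and q: "ultrafilter_on X q"
    and D: "{x\<in>X. f x = 0} \<in> q"
    and add: "\<And>x y. x \<in> X \<Longrightarrow> y \<in> X \<Longrightarrow> f (x + y) = f x + f y"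
    and X: "\<And>x y. x \<in> X \<Longrightarrow> y \<in> X \<Longrightarrow> x + y \<in> X"
  shows "ultrafilter_image X Y f (ultrafilter_plus X p q) = ultrafilter_image X Y f p"
proof -
  have "{y\<in>X. x + y \<in> {x\<in>X. f x \<in> B}} \<in> q \<longleftrightarrow> f x \<in> B" if x: "x \<in> X" for x B
  proof -
    have "{y\<in>X. x + y \<in> {x\<in>X. f x \<in> B}} \<in> q \<longleftrightarrow> {y\<in>X. f x \<in> B} \<in> q"
      by (rule ultrafilter_on_cong[OF q D]) (use x add X in simp)
    then show ?thesis using ultrafilter_onD(2,3)[OF q] by (cases "f x \<in> B") simp_all
  qed
  then have "{x\<in>X. {y\<in>X. x + y \<in> {x\<in>X. f x \<in> B}} \<in> q} = {x\<in>X. f x \<in> B}" for B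
    by (intro Collect_cong conj_cong) auto
  then show ?thesis unfolding ultrafilter_plus_def ultrafilter_image_def by simp
qed

subsection \<open>First entries systems in central sets\<close>

text \<open>Coefficients are natural numbers because \<open>insert 0 S\<close> is closed under
  natural multiples, but not in general under others.\<close>

definition linear_form :: "nat \<Rightarrow> (nat \<Rightarrow> nat) \<Rightarrow> (nat \<Rightarrow> real) \<Rightarrow> real" where
  "linear_form n b y = (\<Sum>j<n. real (b j) * y j)"

lemma linear_form_add: "linear_form n b (x + y) = linear_form n b x + linear_form n b y"
  by (simp add: linear_form_def sum.distrib ring_distribs)

context dense_semigroup
begin

text \<open>The adjoined 0 makes room for tuples supported on one axis and for coordinates that have
  not been treated yet.\<close>

definition tuples :: "(nat \<Rightarrow> real) set" where
  "tuples = {y. \<forall>j. y j \<in> insert 0 S}"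

lemma insert_zero_add: "x \<in> insert 0 S \<Longrightarrow> y \<in> insert 0 S \<Longrightarrow> x + y \<in> insert 0 S"
  using S_add by auto

lemma insert_zero_mult: "x \<in> insert 0 S \<Longrightarrow> real m * x \<in> insert 0 S"
proof (induction m)
  case (Suc m)
  have "real (Suc m) * x = x + real m * x" by (simp add: ring_distribs)
  then show ?case using insert_zero_add[OF Suc.prems Suc.IH[OF Suc.prems]] by presburger
qed simp

lemma insert_zero_sum:
  "finite I \<Longrightarrow> (\<And>i. i \<in> I \<Longrightarrow> g i \<in> insert 0 S) \<Longrightarrow> sum g I \<in> insert 0 S"
proof (induction I rule: finite_induct)
  case (insert i I)
  have "g i + sum g I \<in> insert 0 S"
    by (rule insert_zero_add[OF insert.prems insert.IH[OF insert.prems]]) simp_all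
  then show ?case by (subst sum.insert[OF insert.hyps])
qed simp

lemma linear_form_tuples: "y \<in> tuples \<Longrightarrow> linear_form n b y \<in> insert 0 S"
  unfolding linear_form_def tuples_def by (intro insert_zero_sum insert_zero_mult) auto

lemma tuples_add: "x \<in> tuples \<Longrightarrow> y \<in> tuples \<Longrightarrow> x + y \<in> tuples"
  using insert_zero_add unfolding tuples_def by simp

sublocale tuples: additive_set tuples
  by unfold_locales (rule tuples_add)

abbreviation tplus (infixl "\<oplus>\<^sub>T" 65) where "v \<oplus>\<^sub>T w \<equiv> ultrafilter_plus tuples v w"

text \<open>\<open>k\<close> will run downwards: forms with leading entry at \<open>k\<close> or
  later already have image \<open>p\<close>. All forms, also those still to be treated, are required
  to tend to 0, which later puts their images into \<open>O_plus S\<close>. Everything is expressed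
  by membership of prescribed sets, so that closedness is immediate.\<close>

definition solutions :: "nat \<Rightarrow> (nat \<Rightarrow> nat) set \<Rightarrow> ((nat \<Rightarrow> nat) \<Rightarrow> nat) \<Rightarrow> real set set \<Rightarrow> nat
    \<Rightarrow> (nat \<Rightarrow> real) set set set" where
  "solutions n \<Phi> lead p k = {w. ultrafilter_on tuples w \<and>
     (\<lambda>(b, \<epsilon>). {y\<in>tuples. linear_form n b y < \<epsilon>}) ` (\<Phi> \<times> {0<..}) \<union>
     (\<lambda>(b, B). {y\<in>tuples. linear_form n b y \<in> B}) ` ({b\<in>\<Phi>. k \<le> lead b} \<times> p) \<subseteq> w}"

lemma solutions_closed: "ultra_closed tuples (solutions n \<Phi> lead p k)"
  unfolding solutions_def by (rule ultra_closedI)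

lemma mem_solutions:
  assumes "ultrafilter_on S p"
  shows "w \<in> solutions n \<Phi> lead p k \<longleftrightarrow> ultrafilter_on tuples w \<and>
     (\<forall>b\<in>\<Phi>. \<forall>\<epsilon>>0. {y\<in>tuples. linear_form n b y < \<epsilon>} \<in> w) \<and>
     (\<forall>b\<in>\<Phi>. k \<le> lead b \<longrightarrow> ultrafilter_image tuples S (linear_form n b) w = p)"
proof -
  have image_eq: "ultrafilter_image tuples S (linear_form n b) w = p \<longleftrightarrow>
      (\<forall>B\<in>p. {y\<in>tuples. linear_form n b y \<in> B} \<in> w)" if w: "ultrafilter_on tuples w" for b
  proof
    assume "ultrafilter_image tuples S (linear_form n b) w = p"
    then show "\<forall>B\<in>p. {y\<in>tuples. linear_form n b y \<in> B} \<in> w"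
      unfolding ultrafilter_image_def by auto
  next
    assume *: "\<forall>B\<in>p. {y\<in>tuples. linear_form n b y \<in> B} \<in> w"
    then have "ultrafilter_on S (ultrafilter_image tuples S (linear_form n b) w)"
      using ultrafilter_onD(2)[OF assms] by (intro ultrafilter_on_image w) simp
    moreover have "p \<subseteq> ultrafilter_image tuples S (linear_form n b) w"
      using * ultrafilter_onD(1)[OF assms] unfolding ultrafilter_image_def by auto
    ultimately show "ultrafilter_image tuples S (linear_form n b) w = p"
      by (rule ultrafilter_on_eqI[OF assms, symmetric])
  qed
  show ?thesis
    by (cases "ultrafilter_on tuples w") (auto simp: solutions_def image_subset_iff image_eq)
qed

lemma near_zero_plus:
  assumes v: "ultrafilter_on tuples v" and w: "ultrafilter_on tuples w"
    and near: "\<And>\<epsilon>. 0 < \<epsilon> \<Longrightarrow> {y\<in>tuples. linear_form n b y < \<epsilon>} \<in> v"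
      "\<And>\<epsilon>. 0 < \<epsilon> \<Longrightarrow> {y\<in>tuples. linear_form n b y < \<epsilon>} \<in> w"
    and "0 < \<epsilon>"
  shows "{y\<in>tuples. linear_form n b y < \<epsilon>} \<in> v \<oplus>\<^sub>T w"
proof -
  have "x \<in> tuples.shift w {y\<in>tuples. linear_form n b y < \<epsilon>}"
    if x: "x \<in> {y\<in>tuples. linear_form n b y < \<epsilon> / 2}" for x
  proof -
    have "{y\<in>tuples. linear_form n b y < \<epsilon> / 2} \<in> w" using \<open>0 < \<epsilon>\<close> by (intro near) simp
    then have "{y\<in>tuples. x + y \<in> {y\<in>tuples. linear_form n b y < \<epsilon>}} \<in> w"
      by (rule ultrafilter_onD(5)[OF w]) (use x tuples_add in \<open>auto simp: linear_form_add\<close>)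
    then show ?thesis using x unfolding tuples.shift_def by simp
  qed
  moreover have "{y\<in>tuples. linear_form n b y < \<epsilon> / 2} \<in> v" using \<open>0 < \<epsilon>\<close> by (intro near) simp
  ultimately have "tuples.shift w {y\<in>tuples. linear_form n b y < \<epsilon>} \<in> v"
    by (intro ultrafilter_onD(5)[OF v _ _ tuples.shift_subset]) auto
  then show ?thesis by (simp add: tuples.mem_uplus)
qed

text \<open>Values lie in \<open>insert 0 S\<close>, and an ultrafilter decides between the two
  parts: the form contributes nothing, or its image is an ultrafilter on \<open>S\<close>.\<close>

lemma linear_form_zero_or_S:
  assumes w: "ultrafilter_on tuples w"
  shows "{y\<in>tuples. linear_form n b y = 0} \<in> w \<or> {y\<in>tuples. linear_form n b y \<in> S} \<in> w"
proof -
  have "{y\<in>tuples. linear_form n b y = 0} \<in> w \<or> tuples - {y\<in>tuples. linear_form n b y = 0} \<in> w"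
    by (rule ultrafilter_onD(6)[OF w]) auto
  moreover have "tuples - {y\<in>tuples. linear_form n b y = 0} = {y\<in>tuples. linear_form n b y \<in> S}"
    using linear_form_tuples pos by auto
  ultimately show ?thesis by simp
qed

lemma image_linear_form_plus:
  assumes "ultrafilter_on tuples v" "ultrafilter_on tuples w"
    and "{y\<in>tuples. linear_form n b y \<in> S} \<in> v" "{y\<in>tuples. linear_form n b y \<in> S} \<in> w"
  shows "ultrafilter_image tuples S (linear_form n b) (v \<oplus>\<^sub>T w) =
    ultrafilter_image tuples S (linear_form n b) v \<oplus>\<^sub>S ultrafilter_image tuples S (linear_form n b) w"
  by (rule ultrafilter_image_plus[OF assms]) (auto simp: linear_form_add tuples_add)

lemma image_linear_form_zero:
  assumes "ultrafilter_on tuples v" "ultrafilter_on tuples w"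
    and "{y\<in>tuples. linear_form n b y = 0} \<in> v"
  shows "ultrafilter_image tuples S (linear_form n b) (v \<oplus>\<^sub>T w) = ultrafilter_image tuples S (linear_form n b) w"
    "ultrafilter_image tuples S (linear_form n b) (w \<oplus>\<^sub>T v) = ultrafilter_image tuples S (linear_form n b) w"
  using ultrafilter_image_plus_zero_left[OF assms] ultrafilter_image_plus_zero_right[OF assms(2,1,3)]
  by (simp_all add: linear_form_add tuples_add)

lemma image_in_O_plus:
  assumes w: "ultrafilter_on tuples w"
    and near: "\<And>\<epsilon>. 0 < \<epsilon> \<Longrightarrow> {y\<in>tuples. linear_form n b y < \<epsilon>} \<in> w"
    and S: "{y\<in>tuples. linear_form n b y \<in> S} \<in> w"
  shows "ultrafilter_image tuples S (linear_form n b) w \<in> O_plus S"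
proof -
  have "{0<..<\<epsilon>} \<inter> S \<in> ultrafilter_image tuples S (linear_form n b) w" if "0 < \<epsilon>" for \<epsilon>
  proof -
    have "{y\<in>tuples. linear_form n b y < \<epsilon>} \<inter> {y\<in>tuples. linear_form n b y \<in> S} \<in> w"
      by (rule ultrafilter_onD(4)[OF w near[OF that] S])
    then have "{y\<in>tuples. linear_form n b y \<in> {0<..<\<epsilon>} \<inter> S} \<in> w"
      by (rule ultrafilter_onD(5)[OF w]) (use pos in auto)
    then show ?thesis unfolding ultrafilter_image_def by simp
  qed
  then show ?thesis
    using ultrafilter_on_image[OF w S] unfolding O_plus_def ultrafilters_def by simp
qed

text \<open>Divided by \<open>d\<close> so that a form with coefficient \<open>d\<close> at
  \<open>k\<close> takes exactly the value \<open>s\<close>.\<close>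

definition axis :: "nat \<Rightarrow> nat \<Rightarrow> real \<Rightarrow> nat \<Rightarrow> real" where
  "axis k d s = (\<lambda>j. if j = k then s / real d else 0)"

lemma axis_add: "axis k d (s + t) = axis k d s + axis k d t"
  by (rule ext) (simp add: axis_def add_divide_distrib)

lemma linear_form_axis:
  "linear_form n b (axis k d s) = (if k < n then real (b k) * (s / real d) else 0)"
proof -
  have "linear_form n b (axis k d s) = (\<Sum>j<n. if j = k then real (b j) * (s / real d) else 0)"
    unfolding linear_form_def axis_def by (intro sum.cong) auto
  then show ?thesis by simp
qed

text \<open>The idempotent \<open>e\<close> alone is not enough: different forms of the block may
  send it to different idempotents in the left ideal of \<open>p\<close>. All of these are right
  identities for \<open>p\<close>, so one summand \<open>P\<close> in front of \<open>e\<close>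
  corrects all the forms at the same time.\<close>

lemma first_entries_step:
  assumes p: "p \<in> minimal_idempotents_near_zero S"
    and d: "0 < d" "(\<lambda>s. real d * s) ` S \<in> p"
    and lead: "\<And>b. b \<in> \<Phi> \<Longrightarrow> b (lead b) = d" "\<And>b j. b \<in> \<Phi> \<Longrightarrow> j < lead b \<Longrightarrow> b j = 0"
    and k: "k < n" and ne: "solutions n \<Phi> lead p (Suc k) \<noteq> {}"
  shows "solutions n \<Phi> lead p k \<noteq> {}"
proof -
  note pD = minimal_idempotentD[OF p]
  have pO: "p \<in> O_plus S" by (rule pD(1))
  have pu: "ultrafilter_on S p" by (rule O_plusD(1)[OF pO])
  note mem = mem_solutions[OF pu]
  let ?im = "\<lambda>b. ultrafilter_image tuples S (linear_form n b)"
  let ?W = "solutions n \<Phi> lead p (Suc k)"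
  define D where "D = (\<lambda>s. real d * s) ` S"
  define P where "P = ultrafilter_image S tuples (axis k d) p"
  have D: "D \<in> p" using d(2) unfolding D_def .
  have axis_D: "axis k d s \<in> tuples" if "s \<in> D" for s
    using that d(1) unfolding D_def axis_def tuples_def by auto
  have DS: "D \<subseteq> S" by (rule ultrafilter_onD(1)[OF pu D])
  have P_mem: "{y\<in>tuples. Q y} \<in> P" if "A \<in> p" "\<And>s. s \<in> A \<Longrightarrow> s \<in> D \<Longrightarrow> Q (axis k d s)" for A Q
  proof -
    have "A \<inter> D \<in> p" by (rule ultrafilter_onD(4)[OF pu that(1) D])
    then have "{s\<in>S. axis k d s \<in> {y\<in>tuples. Q y}} \<in> p"
      by (rule ultrafilter_onD(5)[OF pu]) (use that(2) axis_D DS in auto)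
    then show ?thesis unfolding P_def ultrafilter_image_def by simp
  qed
  have Pu: "ultrafilter_on tuples P"
    unfolding P_def
  proof (rule ultrafilter_on_image[OF pu])
    show "{x\<in>S. axis k d x \<in> tuples} \<in> p"
      by (rule ultrafilter_onD(5)[OF pu D]) (use axis_D DS in auto)
  qed
  have Pidem: "P \<oplus>\<^sub>T P = P"
  proof -
    have "ultrafilter_image S tuples (axis k d) (p \<oplus>\<^sub>S p) = P \<oplus>\<^sub>T P"
      unfolding P_def
      by (rule ultrafilter_image_plus[OF pu pu D D]) (use axis_D axis_add S_add in auto)
    then show ?thesis unfolding P_def pD(2) by simp
  qed
  have Pnear: "{y\<in>tuples. linear_form n b y < \<epsilon>} \<in> P" if "0 < \<epsilon>" for b \<epsilon>
  proof (rule P_mem)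
    \<comment> \<open>Chosen to force \<open>b k * s / d < \<epsilon>\<close>; the
      \<open>+ 1\<close> covers \<open>b k = 0\<close>.\<close>
    define \<delta> where "\<delta> = \<epsilon> * real d / (real (b k) + 1)"
    show "{0<..<\<delta>} \<inter> S \<in> p"
      using that d(1) unfolding \<delta>_def by (intro O_plusD(2)[OF pO]) simp
    fix s assume s: "s \<in> {0<..<\<delta>} \<inter> S"
    then have "s * (real (b k) + 1) < \<epsilon> * real d" unfolding \<delta>_def by (simp add: pos_less_divide_eq)
    moreover have "real (b k) * s \<le> s * (real (b k) + 1)" using s by (simp add: algebra_simps)
    ultimately have "real (b k) * s < \<epsilon> * real d" by linarith
    then show "linear_form n b (axis k d s) < \<epsilon>"
      using that d(1) unfolding linear_form_axis by (simp add: pos_divide_less_eq)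
  qed
  have Pzero: "{y\<in>tuples. linear_form n b y = 0} \<in> P" if "b \<in> \<Phi>" "Suc k \<le> lead b" for b
    by (rule P_mem[OF D]) (use lead(2)[OF that(1), of k] that(2) in \<open>simp add: linear_form_axis\<close>)
  have Pim: "?im b P = p" if b: "b \<in> \<Phi>" "lead b = k" for b
  proof -
    have eq: "linear_form n b (axis k d s) = s" for s
      using lead(1)[OF b(1)] b(2) k d(1) unfolding linear_form_axis by simp
    have "{y\<in>tuples. linear_form n b y \<in> B} \<in> P" if "B \<in> p" for B
      by (rule P_mem[OF that]) (simp add: eq)
    then have "p \<subseteq> ?im b P" and S: "{y\<in>tuples. linear_form n b y \<in> S} \<in> P"
      using ultrafilter_onD(1,2)[OF pu] by (auto simp: ultrafilter_image_def[of tuples S])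
    then show ?thesis
      by (intro ultrafilter_on_eqI[OF pu ultrafilter_on_image[OF Pu S], symmetric])
  qed
  have W: "ultrafilter_on tuples w"
    "\<And>b \<epsilon>. b \<in> \<Phi> \<Longrightarrow> 0 < \<epsilon> \<Longrightarrow> {y\<in>tuples. linear_form n b y < \<epsilon>} \<in> w"
    "\<And>b. b \<in> \<Phi> \<Longrightarrow> Suc k \<le> lead b \<Longrightarrow> ?im b w = p" if "w \<in> ?W" for w
    using that unfolding mem by simp_all
  have W_S: "{y\<in>tuples. linear_form n b y \<in> S} \<in> w" if "?im b w = p" for w b
    using ultrafilter_onD(2)[OF pu] unfolding that[symmetric] ultrafilter_image_def by simp
  have W_add: "v \<oplus>\<^sub>T w \<in> ?W" if vw: "v \<in> ?W" "w \<in> ?W" for v w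
    unfolding mem
  proof (intro conjI ballI allI impI)
    note v = W[OF vw(1)] and w = W[OF vw(2)]
    show "ultrafilter_on tuples (v \<oplus>\<^sub>T w)" by (rule tuples.ultrafilter_uplus[OF v(1) w(1)])
    show "{y\<in>tuples. linear_form n b y < \<epsilon>} \<in> v \<oplus>\<^sub>T w" if "b \<in> \<Phi>" "0 < \<epsilon>" for b \<epsilon>
      by (rule near_zero_plus[OF v(1) w(1) v(2)[OF that(1)] w(2)[OF that(1)] that(2)])
    show "?im b (v \<oplus>\<^sub>T w) = p" if b: "b \<in> \<Phi>" "Suc k \<le> lead b" for b
      using image_linear_form_plus[OF v(1) w(1) W_S[OF v(3)[OF b]] W_S[OF w(3)[OF b]]]
      unfolding v(3)[OF b] w(3)[OF b] pD(2) .
  qed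
  \<comment> \<open>Forms of the blocks already treated vanish on axis \<open>k\<close>, so
    \<open>P\<close> may be added on either side. On the right this gives the closed semigroup
    \<open>?Z\<close>, on the left the final ultrafilter.\<close>
  have W_P: "w \<oplus>\<^sub>T P \<in> ?W" "P \<oplus>\<^sub>T w \<in> ?W" if w0: "w \<in> ?W" for w
  proof -
    note w = W[OF w0]
    show "w \<oplus>\<^sub>T P \<in> ?W"
      unfolding mem
    proof (intro conjI ballI allI impI)
      show "ultrafilter_on tuples (w \<oplus>\<^sub>T P)" by (rule tuples.ultrafilter_uplus[OF w(1) Pu])
      show "{y\<in>tuples. linear_form n b y < \<epsilon>} \<in> w \<oplus>\<^sub>T P" if "b \<in> \<Phi>" "0 < \<epsilon>" for b \<epsilon>
        by (rule near_zero_plus[OF w(1) Pu w(2)[OF that(1)] Pnear that(2)])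
      show "?im b (w \<oplus>\<^sub>T P) = p" if b: "b \<in> \<Phi>" "Suc k \<le> lead b" for b
        using image_linear_form_zero(2)[OF Pu w(1) Pzero[OF b]] w(3)[OF b] by simp
    qed
    show "P \<oplus>\<^sub>T w \<in> ?W"
      unfolding mem
    proof (intro conjI ballI allI impI)
      show "ultrafilter_on tuples (P \<oplus>\<^sub>T w)" by (rule tuples.ultrafilter_uplus[OF Pu w(1)])
      show "{y\<in>tuples. linear_form n b y < \<epsilon>} \<in> P \<oplus>\<^sub>T w" if "b \<in> \<Phi>" "0 < \<epsilon>" for b \<epsilon>
        by (rule near_zero_plus[OF Pu w(1) Pnear w(2)[OF that(1)] that(2)])
      show "?im b (P \<oplus>\<^sub>T w) = p" if b: "b \<in> \<Phi>" "Suc k \<le> lead b" for b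
        using image_linear_form_zero(1)[OF Pu w(1) Pzero[OF b]] w(3)[OF b] by simp
    qed
  qed
  let ?Z = "(\<lambda>w. w \<oplus>\<^sub>T P) ` ?W"
  have "\<exists>e\<in>?Z. e \<oplus>\<^sub>T e = e"
  proof (rule tuples.idempotent_in_closed_subsemigroup)
    show "ultra_closed tuples ?Z" by (rule tuples.ultra_closed_translate[OF solutions_closed Pu])
    show "?Z \<noteq> {}" using ne by simp
    fix x y assume "x \<in> ?Z" "y \<in> ?Z"
    then obtain v w where vw: "v \<in> ?W" "x = v \<oplus>\<^sub>T P" "w \<in> ?W" "y = w \<oplus>\<^sub>T P" by auto
    have "x \<oplus>\<^sub>T y = v \<oplus>\<^sub>T P \<oplus>\<^sub>T w \<oplus>\<^sub>T P"
      unfolding vw(2,4)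
      by (rule tuples.uplus_assoc[OF W(1)[OF W_P(1)[OF vw(1)]] W(1)[OF vw(3)] Pu, symmetric])
    then show "x \<oplus>\<^sub>T y \<in> ?Z" using W_add[OF W_P(1)[OF vw(1)] vw(3)] by simp
  qed
  then obtain w where w0: "w \<in> ?W" and e: "w \<oplus>\<^sub>T P \<oplus>\<^sub>T (w \<oplus>\<^sub>T P) = w \<oplus>\<^sub>T P" by auto
  note w = W[OF w0]
  define e where "e = w \<oplus>\<^sub>T P"
  have eW: "e \<in> ?W" and ee: "e \<oplus>\<^sub>T e = e" using W_P(1)[OF w0] e unfolding e_def by simp_all
  note eu = W(1)[OF eW]
  have im: "?im b (P \<oplus>\<^sub>T e) = p" if b: "b \<in> \<Phi>" "lead b = k" for b
  proof -
    note P_S = W_S[OF Pim[OF b]]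
    have e_S: "{y\<in>tuples. linear_form n b y \<in> S} \<in> e" and pe: "p \<oplus>\<^sub>S ?im b e = p"
    proof -
      \<comment> \<open>A new form may ignore all coordinates treated so far, or \<open>w\<close>
        may be concentrated at 0. Then \<open>e\<close> is already sent to \<open>p\<close>, and
        idempotency of \<open>p\<close> suffices.\<close>
      consider "{y\<in>tuples. linear_form n b y = 0} \<in> w" | "{y\<in>tuples. linear_form n b y \<in> S} \<in> w"
        using linear_form_zero_or_S[OF w(1)] by auto
      then have "{y\<in>tuples. linear_form n b y \<in> S} \<in> e \<and> p \<oplus>\<^sub>S ?im b e = p"
      proof cases
        case 1
        have "?im b e = p" using image_linear_form_zero(1)[OF w(1) Pu 1] Pim[OF b] unfolding e_def by simp
        then show ?thesis using W_S pD(2) by simp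
      next
        case 2
        have eq: "?im b e = ?im b w \<oplus>\<^sub>S p"
          using image_linear_form_plus[OF w(1) Pu 2 P_S] Pim[OF b] unfolding e_def by simp
        have wO: "?im b w \<in> O_plus S" by (rule image_in_O_plus[OF w(1) w(2)[OF b(1)] 2])
        have "S \<in> ?im b e"
          using ultrafilter_onD(2)[OF O_plusD(1)[OF O_plus_add[OF wO pO]]] unfolding eq .
        then have e_S: "{y\<in>tuples. linear_form n b y \<in> S} \<in> e" unfolding ultrafilter_image_def by simp
        have "?im b e \<oplus>\<^sub>S ?im b e = ?im b e"
          using image_linear_form_plus[OF eu eu e_S e_S] unfolding ee by simp
        then show ?thesis using pD(3)[OF wO eq] e_S by simp
      qed
      then show "{y\<in>tuples. linear_form n b y \<in> S} \<in> e" "p \<oplus>\<^sub>S ?im b e = p" by simp_all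
    qed
    show ?thesis using image_linear_form_plus[OF Pu eu P_S e_S] Pim[OF b] pe by simp
  qed
  have "P \<oplus>\<^sub>T e \<in> solutions n \<Phi> lead p k"
    unfolding mem
  proof (intro conjI ballI allI impI)
    note Pe = W[OF W_P(2)[OF eW]]
    show "ultrafilter_on tuples (P \<oplus>\<^sub>T e)" by (rule Pe(1))
    show "{y\<in>tuples. linear_form n b y < \<epsilon>} \<in> P \<oplus>\<^sub>T e" if "b \<in> \<Phi>" "0 < \<epsilon>" for b \<epsilon>
      by (rule Pe(2)[OF that])
    show "?im b (P \<oplus>\<^sub>T e) = p" if "b \<in> \<Phi>" "k \<le> lead b" for b
      using im[OF that(1)] Pe(3)[OF that(1)] that(2) by (cases "lead b = k") simp_all
  qed
  then show ?thesis by auto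
qed

text \<open>Downward induction on the block index. The values of \<open>y\<close> may include 0;
  that a particular coordinate lies in \<open>S\<close> has to be enforced by an additional
  form.\<close>

theorem first_entries_in_central:
  assumes p: "p \<in> minimal_idempotents_near_zero S" and C: "C \<in> p"
    and d: "0 < d" "(\<lambda>s. real d * s) ` S \<in> p"
    and fin: "finite \<Phi>"
    and lead: "\<And>b. b \<in> \<Phi> \<Longrightarrow> lead b < n" "\<And>b. b \<in> \<Phi> \<Longrightarrow> b (lead b) = d"
      "\<And>b j. b \<in> \<Phi> \<Longrightarrow> j < lead b \<Longrightarrow> b j = 0"
  shows "\<exists>y. (\<forall>j. y j \<in> insert 0 S) \<and> (\<forall>b\<in>\<Phi>. linear_form n b y \<in> C)"
proof -
  have pu: "ultrafilter_on S p" by (rule O_plusD(1)[OF minimal_idempotentD(1)[OF p]])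
  have zero: "0 \<in> tuples" unfolding tuples_def by simp
  have "solutions n \<Phi> lead p (n - i) \<noteq> {}" for i
  proof (induction i)
    case 0
    \<comment> \<open>The principal ultrafilter at the zero tuple serves as a start, since no form
      has its leading entry at \<open>n\<close> or later.\<close>
    have "{B. B \<subseteq> tuples \<and> 0 \<in> B} \<in> solutions n \<Phi> lead p n"
      unfolding mem_solutions[OF pu]
    proof (intro conjI ballI allI impI)
      show "ultrafilter_on tuples {B. B \<subseteq> tuples \<and> 0 \<in> B}"
        using zero unfolding ultrafilter_on_def by auto
      show "{y\<in>tuples. linear_form n b y < \<epsilon>} \<in> {B. B \<subseteq> tuples \<and> 0 \<in> B}" if "0 < \<epsilon>" for b \<epsilon>
        using that zero unfolding linear_form_def by simp
      show "ultrafilter_image tuples S (linear_form n b) {B. B \<subseteq> tuples \<and> 0 \<in> B} = p"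
        if "b \<in> \<Phi>" "n \<le> lead b" for b
        using lead(1)[OF that(1)] that(2) by simp
    qed
    then show ?case by auto
  next
    case (Suc i)
    show ?case
    proof (cases "i < n")
      case True
      then have *: "n - i = Suc (n - Suc i)" "n - Suc i < n" by simp_all
      show ?thesis
        by (rule first_entries_step[OF p d]) (use Suc.IH * lead(2,3) in simp_all)
    next
      case False
      then show ?thesis using Suc.IH by simp
    qed
  qed
  from this[of n] obtain w where w: "w \<in> solutions n \<Phi> lead p 0" by auto
  then have wu: "ultrafilter_on tuples w"
    and "\<And>b. b \<in> \<Phi> \<Longrightarrow> ultrafilter_image tuples S (linear_form n b) w = p"
    unfolding mem_solutions[OF pu] by simp_all
  then have "{y\<in>tuples. linear_form n b y \<in> C} \<in> w" if "b \<in> \<Phi>" for b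
    using C that unfolding ultrafilter_image_def by auto
  then have sol: "{y\<in>tuples. \<forall>b\<in>\<Phi>. linear_form n b y \<in> C} \<in> w"
    by (rule ultrafilter_on_finite_Ball[OF wu fin])
  have "{y\<in>tuples. \<forall>b\<in>\<Phi>. linear_form n b y \<in> C} \<noteq> {}"
  proof
    assume eq: "{y\<in>tuples. \<forall>b\<in>\<Phi>. linear_form n b y \<in> C} = {}"
    show False using sol ultrafilter_onD(3)[OF wu] unfolding eq by simp
  qed
  then obtain y where "y \<in> tuples" "\<forall>b\<in>\<Phi>. linear_form n b y \<in> C" by auto
  then show ?thesis unfolding tuples_def by (intro exI[of _ y]) simp
qed

end

subsection \<open>Rado's argument for image partition regular matrices\<close>

lemma exists_between_finite:
  fixes L U :: "real set"
  assumes "finite L" "finite U" "\<And>l u. l \<in> L \<Longrightarrow> u \<in> U \<Longrightarrow> l \<le> u"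
  shows "\<exists>t. (\<forall>l\<in>L. l \<le> t) \<and> (\<forall>u\<in>U. t \<le> u)"
proof (cases "L = {}")
  case True
  show ?thesis
  proof (cases "U = {}")
    case False
    then show ?thesis using True assms(2) by (intro exI[of _ "Min U"]) simp
  qed (use True in simp)
next
  case False
  then show ?thesis using assms by (intro exI[of _ "Max L"]) auto
qed

text \<open>Fourier-Motzkin elimination of the last variable: every constraint with positive last
  coefficient is combined with every one with negative last coefficient.\<close>

lemma approximately_solvable_imp_solvable:
  fixes \<Phi> :: "((nat \<Rightarrow> real) \<times> real) set"
  assumes "finite \<Phi>"
    and "\<And>\<epsilon>. 0 < \<epsilon> \<Longrightarrow> \<exists>x. \<forall>(a, b)\<in>\<Phi>. (\<Sum>j<n. a j * x j) \<le> b + \<epsilon>"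
  shows "\<exists>x. \<forall>(a, b)\<in>\<Phi>. (\<Sum>j<n. a j * x j) \<le> b"
  using assms
proof (induction n arbitrary: \<Phi>)
  case 0
  \<comment> \<open>The passage to the limit happens here, where no variable is left.\<close>
  have "0 \<le> b" if "(a, b) \<in> \<Phi>" for a b
  proof (rule field_le_epsilon)
    fix \<epsilon> :: real assume "0 < \<epsilon>"
    from 0(2)[OF this] show "0 \<le> b + \<epsilon>" using that by auto
  qed
  then show ?case by auto
next
  case (Suc n)
  define Z where "Z = {c\<in>\<Phi>. fst c n = 0}"
  define P where "P = {c\<in>\<Phi>. 0 < fst c n}"
  define N where "N = {c\<in>\<Phi>. fst c n < 0}"
  \<comment> \<open>For \<open>c\<close> in \<open>P\<close> and \<open>c'\<close> in
    \<open>N\<close> the multipliers \<open>fst c n\<close> and \<open>- fst c' n\<close> are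
    positive, and they make the last variable cancel.\<close>
  define comb where "comb c c' = ((\<lambda>j. fst c n * fst c' j - fst c' n * fst c j),
    fst c n * snd c' - fst c' n * snd c)" for c c' :: "(nat \<Rightarrow> real) \<times> real"
  define \<Phi>' where "\<Phi>' = Z \<union> (\<lambda>(c, c'). comb c c') ` (P \<times> N)"
  define M where "M = 1 + (\<Sum>c\<in>\<Phi>. \<bar>fst c n\<bar>)"
  have M: "\<bar>fst c n\<bar> \<le> M" if "c \<in> \<Phi>" for c
    unfolding M_def using member_le_sum[OF that _ Suc.prems(1), of "\<lambda>c. \<bar>fst c n\<bar>"] by simp
  have M1: "1 \<le> M" unfolding M_def by (simp add: sum_nonneg)
  have fin: "finite Z" "finite P" "finite N" using Suc.prems(1) unfolding Z_def P_def N_def by simp_all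
  let ?s = "\<lambda>c x. \<Sum>j<n. fst c j * x j"
  have comb_sum: "(\<Sum>j<n. fst (comb c c') j * x j) = fst c n * ?s c' x - fst c' n * ?s c x" for c c' x
    unfolding comb_def by (simp add: sum_distrib_left sum_subtractf[symmetric] algebra_simps)
  have "\<exists>x. \<forall>(a, b)\<in>\<Phi>'. (\<Sum>j<n. a j * x j) \<le> b"
  proof (rule Suc.IH)
    show "finite \<Phi>'" unfolding \<Phi>'_def using fin by simp
    fix \<epsilon> :: real assume e: "0 < \<epsilon>"
    \<comment> \<open>A combination inflates the slack by at most \<open>2 * M\<close>, and
      \<open>1 \<le> M\<close> gives \<open>\<delta> \<le> \<epsilon>\<close> for the constraints
      taken over from \<open>Z\<close>.\<close>
    define \<delta> where "\<delta> = \<epsilon> / (2 * M)"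
    have d: "0 < \<delta>" "\<delta> \<le> \<epsilon>" "\<delta> * (2 * M) = \<epsilon>"
      using e M1 unfolding \<delta>_def by (simp_all add: divide_le_eq mult_le_cancel_left1)
    obtain x where x: "\<forall>(a, b)\<in>\<Phi>. (\<Sum>j<Suc n. a j * x j) \<le> b + \<delta>"
      using Suc.prems(2)[OF d(1)] by auto
    have xc: "?s c x + fst c n * x n \<le> snd c + \<delta>" if "c \<in> \<Phi>" for c
      using x that by (auto simp: case_prod_beta)
    have "(\<Sum>j<n. fst c j * x j) \<le> snd c + \<epsilon>" if "c \<in> \<Phi>'" for c
    proof -
      consider "c \<in> Z" | c1 c2 where "c1 \<in> P" "c2 \<in> N" "c = comb c1 c2"
        using \<open>c \<in> \<Phi>'\<close> unfolding \<Phi>'_def by auto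
      then show ?thesis
      proof cases
        case 1
        then show ?thesis using xc[of c] d(2) unfolding Z_def by simp
      next
        case 2
        have c12: "c1 \<in> \<Phi>" "c2 \<in> \<Phi>" "0 < fst c1 n" "fst c2 n < 0" using 2 unfolding P_def N_def by simp_all
        have "fst c1 n * (?s c2 x + fst c2 n * x n) \<le> fst c1 n * (snd c2 + \<delta>)"
          using xc[OF c12(2)] c12(3) by (intro mult_left_mono) simp_all
        moreover have "- fst c2 n * (?s c1 x + fst c1 n * x n) \<le> - fst c2 n * (snd c1 + \<delta>)"
          using xc[OF c12(1)] c12(4) by (intro mult_left_mono) simp_all
        moreover have "\<delta> * (fst c1 n - fst c2 n) \<le> \<delta> * (2 * M)"
          using M[OF c12(1)] M[OF c12(2)] d(1) by (intro mult_left_mono) simp_all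
        ultimately have "fst c1 n * ?s c2 x - fst c2 n * ?s c1 x
            \<le> fst c1 n * snd c2 - fst c2 n * snd c1 + \<epsilon>"
          unfolding d(3) by (simp add: algebra_simps)
        then show ?thesis unfolding 2(3) comb_sum by (simp add: comb_def)
      qed
    qed
    then show "\<exists>x. \<forall>(a, b)\<in>\<Phi>'. (\<Sum>j<n. a j * x j) \<le> b + \<epsilon>"
      by (intro exI[of _ x]) (simp add: case_prod_beta)
  qed
  then obtain x where "\<forall>(a, b)\<in>\<Phi>'. (\<Sum>j<n. a j * x j) \<le> b" by auto
  then have x: "?s c x \<le> snd c" if "c \<in> \<Phi>'" for c using that by (auto simp: case_prod_beta)
  have "\<exists>t. (\<forall>l\<in>(\<lambda>c. (snd c - ?s c x) / fst c n) ` N. l \<le> t) \<and>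
      (\<forall>u\<in>(\<lambda>c. (snd c - ?s c x) / fst c n) ` P. t \<le> u)"
  proof (rule exists_between_finite)
    fix l u assume "l \<in> (\<lambda>c. (snd c - ?s c x) / fst c n) ` N" "u \<in> (\<lambda>c. (snd c - ?s c x) / fst c n) ` P"
    then obtain c2 c1 where c: "c2 \<in> N" "c1 \<in> P"
      and lu: "l = (snd c2 - ?s c2 x) / fst c2 n" "u = (snd c1 - ?s c1 x) / fst c1 n" by auto
    have sgn: "0 < fst c1 n" "fst c2 n < 0" using c unfolding P_def N_def by simp_all
    have "comb c1 c2 \<in> \<Phi>'" using c unfolding \<Phi>'_def by auto
    from x[OF this] have "fst c1 n * ?s c2 x - fst c2 n * ?s c1 x \<le> fst c1 n * snd c2 - fst c2 n * snd c1"
      unfolding comb_sum by (simp add: comb_def)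
    then have "fst c2 n * (snd c1 - ?s c1 x) \<le> fst c1 n * (snd c2 - ?s c2 x)"
      by (simp add: algebra_simps)
    then show "l \<le> u" unfolding lu using sgn by (simp add: field_simps)
  qed (use fin in simp_all)
  then obtain t where t: "\<And>c. c \<in> N \<Longrightarrow> (snd c - ?s c x) / fst c n \<le> t"
    "\<And>c. c \<in> P \<Longrightarrow> t \<le> (snd c - ?s c x) / fst c n" by auto
  have "?s c x + fst c n * t \<le> snd c" if c: "c \<in> \<Phi>" for c
  proof -
    consider "c \<in> Z" | "c \<in> P" | "c \<in> N" using c unfolding Z_def P_def N_def by force
    then show ?thesis
    proof cases
      case 1
      then show ?thesis using x[of c] unfolding \<Phi>'_def Z_def by simp
    next
      case 2
      then show ?thesis using t(2)[OF 2] unfolding P_def by (simp add: field_simps)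
    next
      case 3
      then show ?thesis using t(1)[OF 3] unfolding N_def by (simp add: field_simps)
    qed
  qed
  moreover have "(\<Sum>j<Suc n. fst c j * (x(n := t)) j) = ?s c x + fst c n * t" for c by simp
  ultimately show ?case
    by (intro exI[of _ "x(n := t)"]) (simp add: case_prod_beta)
qed

text \<open>The cone spanned by the columns of \<open>A\<close> is closed. Solutions for small
  tolerances may be unbounded, so no compactness argument applies to them directly; equations become
  pairs of inequalities and sign conditions further inequalities.\<close>

lemma approximate_nonneg_solution_imp_solution:
  fixes A :: "'i \<Rightarrow> nat \<Rightarrow> real"
  assumes "finite I"
    and approx: "\<And>\<epsilon>. 0 < \<epsilon> \<Longrightarrow> \<exists>x. (\<forall>j<v. 0 \<le> x j) \<and> (\<forall>i\<in>I. \<bar>(\<Sum>j<v. A i j * x j) - t i\<bar> \<le> \<epsilon>)"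
  shows "\<exists>x. (\<forall>j<v. 0 \<le> x j) \<and> (\<forall>i\<in>I. (\<Sum>j<v. A i j * x j) = t i)"
proof -
  define \<Phi> where "\<Phi> = (\<lambda>i. (A i, t i)) ` I \<union> (\<lambda>i. (\<lambda>j. - A i j, - t i)) ` I \<union>
    (\<lambda>k. (\<lambda>j. if j = k then -1 else 0, 0)) ` {..<v}"
  have neg: "(\<Sum>j<v. (if j = k then -1 else 0) * x j) = - x k" if "k < v" for k and x :: "nat \<Rightarrow> real"
  proof -
    have "(\<Sum>j<v. (if j = k then -1 else 0) * x j) = (\<Sum>j<v. if j = k then - x k else 0)"
      by (intro sum.cong) auto
    then show ?thesis using that by simp
  qed
  have "\<exists>x. \<forall>(a, b)\<in>\<Phi>. (\<Sum>j<v. a j * x j) \<le> b"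
  proof (rule approximately_solvable_imp_solvable)
    show "finite \<Phi>" using assms(1) unfolding \<Phi>_def by simp
    fix \<epsilon> :: real assume "0 < \<epsilon>"
    then obtain x where x: "\<forall>j<v. 0 \<le> x j" "\<forall>i\<in>I. \<bar>(\<Sum>j<v. A i j * x j) - t i\<bar> \<le> \<epsilon>"
      using approx by meson
    have "\<bar>(\<Sum>j<v. A i j * x j) - t i\<bar> \<le> \<epsilon>" if "i \<in> I" for i using x(2) that by simp
    then have "(\<Sum>j<v. A i j * x j) \<le> t i + \<epsilon>" "- (\<Sum>j<v. A i j * x j) \<le> - t i + \<epsilon>" if "i \<in> I" for i
      using that by (simp_all add: abs_le_iff algebra_simps)
    then show "\<exists>x. \<forall>(a, b)\<in>\<Phi>. (\<Sum>j<v. a j * x j) \<le> b + \<epsilon>"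
      using x(1) \<open>0 < \<epsilon>\<close> by (intro exI[of _ x]) (auto simp: \<Phi>_def neg sum_negf add_increasing2)
  qed
  then obtain x where x: "\<forall>(a, b)\<in>\<Phi>. (\<Sum>j<v. a j * x j) \<le> b" by auto
  have "0 \<le> x k" if "k < v" for k
  proof -
    have "(\<lambda>j. if j = k then -1 else 0, 0) \<in> \<Phi>" using that unfolding \<Phi>_def by auto
    from bspec[OF x this] show ?thesis using neg[OF that, of x] by simp
  qed
  moreover have "(\<Sum>j<v. A i j * x j) = t i" if "i \<in> I" for i
    using x that unfolding \<Phi>_def by (auto simp: ball_Un sum_negf intro!: antisym)
  ultimately show ?thesis by (intro exI[of _ x]) simp
qed

text \<open>\<open>real D\<close> times the defect of the rounded relation is an integer, and the
  rounding errors keep it below 1 in absolute value. Used both to make real solutions integral and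
  to carry relations from \<open>S\<close> to the integers.\<close>

lemma rounded_relation:
  fixes c x :: "nat \<Rightarrow> real" and z :: "nat \<Rightarrow> int"
  assumes c: "\<And>j. j < v \<Longrightarrow> real D * c j \<in> \<int>" and m: "real D * m \<in> \<int>" and "0 < D"
    and x: "\<And>j. j < v \<Longrightarrow> \<bar>q * x j - of_int (z j)\<bar> \<le> \<delta>" and y: "\<bar>q * y - m\<bar> \<le> \<delta>"
    and eq: "(\<Sum>j<v. c j * x j) = y"
    and small: "\<delta> * (real D * ((\<Sum>j<v. \<bar>c j\<bar>) + 1)) < 1"
  shows "(\<Sum>j<v. c j * of_int (z j)) = m"
proof -
  let ?r = "(\<Sum>j<v. c j * of_int (z j)) - m"
  have "real D * ?r = (\<Sum>j<v. (real D * c j) * of_int (z j)) - real D * m"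
    by (simp add: sum_distrib_left algebra_simps)
  also have "\<dots> \<in> \<int>"
    by (intro Ints_diff[OF Ints_sum m] Ints_mult[OF c]) auto
  finally have int: "real D * ?r \<in> \<int>" .
  have "?r = (q * y - m) - (\<Sum>j<v. c j * (q * x j - of_int (z j)))"
    unfolding eq[symmetric] by (simp add: sum_distrib_left sum_subtractf algebra_simps)
  also have "\<bar>\<dots>\<bar> \<le> \<bar>q * y - m\<bar> + \<bar>\<Sum>j<v. c j * (q * x j - of_int (z j))\<bar>"
    by (rule abs_triangle_ineq4)
  also have "\<bar>\<Sum>j<v. c j * (q * x j - of_int (z j))\<bar> \<le> (\<Sum>j<v. \<bar>c j\<bar> * \<delta>)"
    using x by (intro order_trans[OF sum_abs] sum_mono) (simp add: abs_mult mult_left_mono)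
  also have "\<bar>q * y - m\<bar> + (\<Sum>j<v. \<bar>c j\<bar> * \<delta>) \<le> \<delta> * ((\<Sum>j<v. \<bar>c j\<bar>) + 1)"
    unfolding sum_distrib_right[symmetric] using y by (simp add: algebra_simps)
  finally have "real D * \<bar>?r\<bar> \<le> \<delta> * (real D * ((\<Sum>j<v. \<bar>c j\<bar>) + 1))"
    using \<open>0 < D\<close> by (simp add: mult.left_commute)
  then have "\<bar>real D * ?r\<bar> < 1" using small by (simp add: abs_mult)
  then have "real D * ?r = 0" using Ints_nonzero_abs_less1[OF int] by simp
  then show ?thesis using \<open>0 < D\<close> by simp
qed

text \<open>By Dirichlet's theorem some multiple of \<open>x\<close> is so close to an integer point
  that \<open>rounded_relation\<close> makes the rounded solution exact; irrational coordinates do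
  no harm.\<close>

lemma integral_nonneg_solution:
  fixes A :: "'i \<Rightarrow> nat \<Rightarrow> real" and x :: "nat \<Rightarrow> real"
  assumes I: "finite I" and D: "0 < D" "\<And>i j. i \<in> I \<Longrightarrow> j < v \<Longrightarrow> real D * A i j \<in> \<int>"
    and x: "\<And>j. j < v \<Longrightarrow> 0 \<le> x j" and eq: "\<And>i. i \<in> I \<Longrightarrow> (\<Sum>j<v. A i j * x j) = of_int (t i)"
  shows "\<exists>q z. 0 < q \<and> (\<forall>i\<in>I. (\<Sum>j<v. A i j * real (z j)) = real q * of_int (t i))"
proof -
  let ?K = "\<lambda>i. real D * ((\<Sum>j<v. \<bar>A i j\<bar>) + 1)"
  obtain N :: nat where N: "(\<Sum>i\<in>I. ?K i) + 1 < real N" using reals_Archimedean2 by auto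
  have K0: "0 \<le> ?K i" for i by (simp add: sum_nonneg)
  then have N0: "0 < N" using N sum_nonneg[of I ?K] by (cases N) auto
  have "\<exists>q p. 0 < q \<and> (\<forall>j<v. \<bar>of_int q * x j - of_int (p j)\<bar> < 1 / real N)"
  proof (rule Dirichlet_approx_simult[OF N0, where \<theta> = x and n = v])
    fix q :: int and p :: "nat \<Rightarrow> int"
    assume "0 < q" "\<And>j. j < v \<Longrightarrow> \<bar>of_int q * x j - of_int (p j)\<bar> < 1 / real N"
    then show ?thesis by (intro exI[of _ q] exI[of _ p]) simp
  qed
  then obtain q p where q: "0 < q"
    and p: "\<And>j. j < v \<Longrightarrow> \<bar>of_int q * x j - of_int (p j)\<bar> < 1 / real N" by auto
  have "0 \<le> p j" if "j < v" for j
  proof -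
    have "0 \<le> of_int q * x j" using q x[OF that] by simp
    moreover have "1 / real N \<le> 1" using N0 by simp
    ultimately have "- 1 < (of_int (p j) :: real)" using p[OF that] by linarith
    then show ?thesis by linarith
  qed
  then have nat_p: "real (nat (p j)) = of_int (p j)" if "j < v" for j using that by simp
  have "(\<Sum>j<v. A i j * of_int (p j)) = of_int q * of_int (t i)" if i: "i \<in> I" for i
  proof (rule rounded_relation[OF D(2)[OF i] _ D(1) less_imp_le[OF p] _ eq[OF i]])
    show "real D * (of_int q * of_int (t i)) \<in> \<int>" by (intro Ints_mult) auto
    have "?K i \<le> (\<Sum>i\<in>I. ?K i)" by (rule member_le_sum[OF i K0 I])
    then have "?K i < real N" using N by linarith
    then show "1 / real N * ?K i < 1" using N0 by simp
    show "\<bar>of_int q * of_int (t i) - of_int q * of_int (t i)\<bar> \<le> 1 / real N" by simp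
  qed auto
  moreover have "real (nat q) = of_int q" using q by simp
  ultimately show ?thesis
    using q nat_p by (intro exI[of _ "nat q"] exI[of _ "\<lambda>j. nat (p j)"]) auto
qed

section \<open>Rational matrices and real sums\<close>

lemma mult_map_vec_of_nat:
  assumes "A \<in> carrier_mat u v" "x \<in> carrier_vec v" "i < u"
  shows "real_of_rat ((A *\<^sub>v map_vec of_nat x) $ i) =
    (\<Sum>j<v. real_of_rat (A $$ (i, j)) * real (x $ j))"
proof -
  have "(A *\<^sub>v map_vec of_nat x) $ i = (\<Sum>j<v. A $$ (i, j) * of_nat (x $ j))"
    using assms by (simp add: scalar_prod_def atLeast0LessThan)
  then show ?thesis by (simp add: of_rat_sum of_rat_mult)
qed

lemma image_partition_regular_real:
  assumes A: "A \<in> carrier_mat u v"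
  shows "image_partition_regular A \<longleftrightarrow> (\<forall>i<u. Matrix.row A i \<noteq> 0\<^sub>v v) \<and>
    (\<forall>col :: nat \<Rightarrow> nat. finite (col ` {0<..}) \<longrightarrow>
      (\<exists>x n c. (\<forall>j<v. 0 < x j) \<and> (\<forall>i<u. 0 < n i \<and> col (n i) = c \<and>
        (\<Sum>j<v. real_of_rat (A $$ (i, j)) * real (x j)) = real (n i))))"
proof -
  have "(\<exists>x\<in>carrier_vec v. (\<forall>j<v. 0 < x $ j) \<and>
        (\<exists>c. \<forall>i<u. \<exists>n>0. (A *\<^sub>v map_vec of_nat x) $ i = of_nat n \<and> col n = c)) \<longleftrightarrow>
      (\<exists>x n c. (\<forall>j<v. 0 < x j) \<and> (\<forall>i<u. 0 < n i \<and> col (n i) = c \<and>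
        (\<Sum>j<v. real_of_rat (A $$ (i, j)) * real (x j)) = real (n i)))"
    (is "?L \<longleftrightarrow> ?R") for col :: "nat \<Rightarrow> nat"
  proof
    assume ?L
    then obtain x c where x: "x \<in> carrier_vec v" "\<forall>j<v. 0 < x $ j"
      and ex: "\<forall>i<u. \<exists>n>0. (A *\<^sub>v map_vec of_nat x) $ i = of_nat n \<and> col n = c" by auto
    then obtain n where n: "\<And>i. i < u \<Longrightarrow> 0 < n i \<and> (A *\<^sub>v map_vec of_nat x) $ i = of_nat (n i) \<and> col (n i) = c"
      by metis
    have "(\<Sum>j<v. real_of_rat (A $$ (i, j)) * real (x $ j)) = real (n i)" if "i < u" for i
      using n[OF that] mult_map_vec_of_nat[OF A x(1) that] by simp
    then show ?R using x(2) n by (intro exI[of _ "\<lambda>j. x $ j"] exI[of _ n] exI[of _ c]) simp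
  next
    assume ?R
    then obtain x n c where x: "\<forall>j<v. 0 < x j" and n: "\<forall>i<u. 0 < n i \<and> col (n i) = c \<and>
        (\<Sum>j<v. real_of_rat (A $$ (i, j)) * real (x j)) = real (n i)" by auto
    have xv: "Matrix.vec v x \<in> carrier_vec v" by simp
    have "(A *\<^sub>v map_vec of_nat (Matrix.vec v x)) $ i = of_nat (n i)" if "i < u" for i
    proof -
      have "real_of_rat ((A *\<^sub>v map_vec of_nat (Matrix.vec v x)) $ i) = real_of_rat (of_nat (n i))"
        using n that mult_map_vec_of_nat[OF A xv that] by simp
      then show ?thesis by (simp only: of_rat_eq_iff)
    qed
    then show ?L using x n xv by (intro bexI[of _ "Matrix.vec v x"]) auto
  qed
  then show ?thesis using A unfolding image_partition_regular_def by simp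
qed

lemma common_denominator:
  obtains D :: nat where "0 < D" "\<And>i j. i < u \<Longrightarrow> j < v \<Longrightarrow> real D * real_of_rat (A $$ (i, j)) \<in> \<int>"
proof
  let ?den = "\<lambda>(i, j). nat (snd (quotient_of (A $$ (i, j))))"
  let ?D = "\<Prod>c\<in>{..<u} \<times> {..<v}. ?den c"
  have pos: "0 < snd (quotient_of (A $$ (i, j)))" for i j by (rule quotient_of_denom_pos')
  then show "0 < ?D" by (intro prod_pos) auto
  fix i j assume ij: "i < u" "j < v"
  obtain a d where q: "quotient_of (A $$ (i, j)) = (a, d)" by (cases "quotient_of (A $$ (i, j))")
  have d: "0 < d" using pos[of i j] q by simp
  have "?den (i, j) dvd ?D" using ij by (intro dvd_prodI) auto
  then obtain k where "?D = nat d * k" using q by (auto elim: dvdE)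
  then have "real ?D = of_int d * real k" using d by simp
  moreover have "real_of_rat (A $$ (i, j)) = of_int a / of_int d"
    using quotient_of_div[OF q] by (simp add: of_rat_divide)
  ultimately have "real ?D * real_of_rat (A $$ (i, j)) = of_int a * of_int (int k)" using d by simp
  also have "\<dots> \<in> \<int>" by (intro Ints_mult) auto
  finally show "real ?D * real_of_rat (A $$ (i, j)) \<in> \<int>" .
qed

section \<open>Colouring by order of magnitude\<close>

lemma rank_by_size:
  fixes f :: "nat \<Rightarrow> int"
  shows "\<exists>k. (\<forall>i<u. k i < u) \<and> (\<forall>i<u. \<forall>i'<u. k i' < k i \<longleftrightarrow> f i < f i')"
proof -
  \<comment> \<open>The rank counts strictly larger entries: the largest have rank 0 and ties share
    a rank. Ranks may be skipped, which later appear as empty blocks.\<close>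
  define S where "S i = {i'. i' < u \<and> f i < f i'}" for i
  have fin: "finite (S i)" for i unfolding S_def by simp
  have "card (S i) < u" if "i < u" for i
  proof -
    have "S i \<subset> {..<u}" using that unfolding S_def by auto
    then show ?thesis using psubset_card_mono[of "{..<u}" "S i"] by simp
  qed
  moreover have "card (S i') < card (S i) \<longleftrightarrow> f i < f i'" if "i' < u" for i i'
  proof
    assume "f i < f i'"
    then have "S i' \<subset> S i" using that unfolding S_def by auto
    then show "card (S i') < card (S i)" by (rule psubset_card_mono[OF fin])
  next
    assume less: "card (S i') < card (S i)"
    show "f i < f i'"
    proof (rule ccontr)
      assume "\<not> f i < f i'"
      then have "S i \<subseteq> S i'" unfolding S_def by auto
      then have "card (S i) \<le> card (S i')" by (rule card_mono[OF fin])
      then show False using less by simp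
    qed
  qed
  ultimately show ?thesis by (intro exI[of _ "\<lambda>i. card (S i)"]) simp
qed

text \<open>The lower bound rests on
  \<open>1 / (1 + \<epsilon>) \<ge> 1 - \<epsilon>\<close>.\<close>

lemma ratio_close_to_one:
  fixes a b \<epsilon> :: real
  assumes "0 < a" "0 < b" "0 < \<epsilon>" "a / b < 1 + \<epsilon>" "b / a < 1 + \<epsilon>"
  shows "\<bar>a / b - 1\<bar> \<le> \<epsilon>"
proof -
  define r where "r = a / b"
  have r: "0 < r" "b / a = 1 / r" using assms(1,2) unfolding r_def by simp_all
  have "1 / r < 1 + \<epsilon>" using assms(5) r(2) by simp
  then have "1 < (1 + \<epsilon>) * r" using r(1) by (simp add: pos_divide_less_eq)
  then have "1 - r < \<epsilon> * r" by (simp add: ring_distribs)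
  moreover have "\<epsilon> * r \<le> \<epsilon> \<or> 1 \<le> r"
    using assms(3) by (cases "r \<le> 1") (simp_all add: mult_left_le)
  ultimately show ?thesis using assms(3,4) unfolding r_def[symmetric] by linarith
qed

text \<open>The colour of \<open>n\<close> is \<open>\<lfloor>log (1 + \<epsilon>) n\<rfloor>\<close> modulo a large number, and \<open>k\<close> ranks the entries by order of
  magnitude.\<close>

lemma magnitude_colouring:
  fixes \<epsilon> :: real
  assumes "0 < \<epsilon>"
  shows "\<exists>col :: nat \<Rightarrow> nat. finite (col ` {0<..}) \<and>
    (\<forall>(u::nat) n c. (\<forall>i<u. 0 < n i \<and> col (n i) = c) \<longrightarrow>
      (\<exists>k. (\<forall>i<u. k i < u) \<and>
        (\<forall>i<u. \<forall>i'<u. k i = k i' \<longrightarrow> \<bar>real (n i) / real (n i') - 1\<bar> \<le> \<epsilon>) \<and>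
        (\<forall>i<u. \<forall>i'<u. k i' < k i \<longrightarrow> real (n i) / real (n i') \<le> \<epsilon>)))"
proof -
  define \<beta> where "\<beta> = 1 + \<epsilon>"
  have \<beta>: "1 < \<beta>" using assms unfolding \<beta>_def by simp
  \<comment> \<open>\<open>\<beta>\<close> bounds ratios within a block, \<open>\<beta> ^ L\<close>
    the gap between blocks. Equal colours with different floors have floors at least
    \<open>M\<close> apart; the 1 in \<open>M\<close> pays for the rounding and leaves more than
    \<open>L\<close> between the logarithms.\<close>
  obtain L where L: "1 / \<epsilon> < \<beta> ^ L" using real_arch_pow[OF \<beta>] by auto
  define M where "M = int L + 1"
  have M: "0 < M" unfolding M_def by simp
  define fl where "fl n = \<lfloor>log \<beta> (real n)\<rfloor>" for n :: nat
  define col where "col n = nat (fl n mod M)" for n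
  have ratio: "real m / real n < \<beta> powr t"
    if mn: "0 < m" "0 < n" and less: "log \<beta> (real m) < log \<beta> (real n) + t" for m n t
  proof -
    have "log \<beta> (real m / real n) = log \<beta> (real m) - log \<beta> (real n)"
      using mn by (simp add: log_divide)
    then have "log \<beta> (real m / real n) < t" using less by simp
    moreover have "0 < real m / real n" using mn by simp
    ultimately show ?thesis using log_less_iff[OF \<beta>] by simp
  qed
  have close: "\<bar>real m / real n - 1\<bar> \<le> \<epsilon>" if mn: "0 < m" "0 < n" and eq: "fl m = fl n" for m n
  proof (rule ratio_close_to_one)
    have "\<bar>log \<beta> (real m) - log \<beta> (real n)\<bar> < 1"
      using eq unfolding fl_def by linarith
    then have less: "log \<beta> (real m) < log \<beta> (real n) + 1" "log \<beta> (real n) < log \<beta> (real m) + 1"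
      by linarith+
    show "real m / real n < 1 + \<epsilon>" "real n / real m < 1 + \<epsilon>"
      using ratio[OF mn less(1)] ratio[OF mn(2,1) less(2)] \<beta> by (simp_all add: \<beta>_def)
  qed (use mn assms in simp_all)
  have far: "real m / real n \<le> \<epsilon>"
    if mn: "0 < m" "0 < n" and less: "fl m < fl n" and eq: "col m = col n" for m n
  proof -
    have "0 \<le> fl m mod M" "0 \<le> fl n mod M" using M by (simp_all add: pos_mod_sign)
    then have "fl n mod M = fl m mod M" using eq unfolding col_def by simp
    then have "M dvd fl n - fl m" by (simp add: mod_eq_dvd_iff)
    then have "M \<le> fl n - fl m" by (rule zdvd_imp_le) (use less in simp)
    then have "log \<beta> (real m) < log \<beta> (real n) + - real L"
      unfolding fl_def M_def by linarith
    then have "real m / real n < \<beta> powr - real L" by (rule ratio[OF mn])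
    also have "\<beta> powr - real L = 1 / \<beta> ^ L" using \<beta> by (simp add: powr_minus_divide powr_realpow)
    also have "1 / \<beta> ^ L < \<epsilon>" using L assms \<beta> by (simp add: field_simps)
    finally show ?thesis by simp
  qed
  have "col n \<le> L" for n
  proof -
    have "fl n mod M < M" by (rule pos_mod_bound[OF M])
    then show ?thesis unfolding col_def M_def by simp
  qed
  then have "col ` {0<..} \<subseteq> {..L}" by auto
  then have fin: "finite (col ` {0<..})" by (rule finite_subset) simp
  have rank: "\<exists>k. (\<forall>i<u. k i < u) \<and>
      (\<forall>i<u. \<forall>i'<u. k i = k i' \<longrightarrow> \<bar>real (n i) / real (n i') - 1\<bar> \<le> \<epsilon>) \<and>
      (\<forall>i<u. \<forall>i'<u. k i' < k i \<longrightarrow> real (n i) / real (n i') \<le> \<epsilon>)"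
    if n: "\<forall>i<u. 0 < n i \<and> col (n i) = c" for u :: nat and n c
  proof -
    obtain k where k: "\<forall>i<u. k i < u"
      and rank: "\<forall>i<u. \<forall>i'<u. k i' < k i \<longleftrightarrow> fl (n i) < fl (n i')"
      using rank_by_size[of u "\<lambda>i. fl (n i)"] by auto
    have "\<bar>real (n i) / real (n i') - 1\<bar> \<le> \<epsilon>" if i: "i < u" "i' < u" "k i = k i'" for i i'
    proof (rule close)
      have "\<not> fl (n i) < fl (n i')" "\<not> fl (n i') < fl (n i)"
        using rank[rule_format, of i i'] rank[rule_format, of i' i] i by simp_all
      then show "fl (n i) = fl (n i')" by simp
    qed (use n i in simp_all)
    moreover have "real (n i) / real (n i') \<le> \<epsilon>" if "i < u" "i' < u" "k i' < k i" for i i'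
      by (rule far) (use n that rank[rule_format, of i i'] in simp_all)
    ultimately show ?thesis using k by (intro exI[of _ k]) simp
  qed
  show ?thesis
  proof (rule exI[of _ col], intro conjI allI impI)
    show "finite (col ` {0<..})" by (rule fin)
  qed (rule rank)
qed

text \<open>Dividing a monochromatic image by one of its entries in block \<open>b\<close> gives 1
  on that block and 0 on smaller entries, up to an error. As there are finitely many rankings, one
  of them serves all tolerances, and closedness of cones removes the error. Larger entries, those
  with \<open>k i < b\<close>, stay free.\<close>

lemma block_solutions:
  assumes A: "A \<in> carrier_mat u v" and ipr: "image_partition_regular A"
  shows "\<exists>k. (\<forall>i<u. k i < u) \<and> (\<forall>b<u. \<exists>x. (\<forall>j<v. 0 \<le> x j) \<and>
    (\<forall>i<u. b \<le> k i \<longrightarrow> (\<Sum>j<v. real_of_rat (A $$ (i, j)) * x j) = (if k i = b then 1 else 0)))"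
proof -
  define s where "s i x = (\<Sum>j<v. real_of_rat (A $$ (i, j)) * x j)" for i and x :: "nat \<Rightarrow> real"
  \<comment> \<open>Extensional functions, so that there are only finitely many rankings; hence the
    \<open>restrict\<close> below.\<close>
  define F where "F = {..<u} \<rightarrow>\<^sub>E {..<u}"
  define apx where "apx \<epsilon> k \<longleftrightarrow> (\<forall>b<u. \<exists>x. (\<forall>j<v. 0 \<le> x j) \<and>
    (\<forall>i<u. b \<le> k i \<longrightarrow> \<bar>s i x - (if k i = b then 1 else 0)\<bar> \<le> \<epsilon>))" for \<epsilon> :: real and k :: "nat \<Rightarrow> nat"
  have apx_mono: "apx \<epsilon>' k" if apx: "apx \<epsilon> k" and le: "\<epsilon> \<le> \<epsilon>'" for \<epsilon> \<epsilon>' k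
    unfolding apx_def
  proof (intro allI impI)
    fix b assume "b < u"
    then obtain x where "\<forall>j<v. 0 \<le> x j"
      "\<forall>i<u. b \<le> k i \<longrightarrow> \<bar>s i x - (if k i = b then 1 else 0)\<bar> \<le> \<epsilon>"
      using apx unfolding apx_def by auto
    then show "\<exists>x. (\<forall>j<v. 0 \<le> x j) \<and> (\<forall>i<u. b \<le> k i \<longrightarrow> \<bar>s i x - (if k i = b then 1 else 0)\<bar> \<le> \<epsilon>')"
      using le by (intro exI[of _ x]) (auto intro: order_trans)
  qed
  have ex: "\<exists>k\<in>F. apx \<epsilon> k" if e: "0 < \<epsilon>" for \<epsilon>
  proof -
    obtain col :: "nat \<Rightarrow> nat" where col: "finite (col ` {0<..})"
      and colour: "\<forall>(u::nat) n c. (\<forall>i<u. 0 < n i \<and> col (n i) = c) \<longrightarrow>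
      (\<exists>k. (\<forall>i<u. k i < u) \<and>
        (\<forall>i<u. \<forall>i'<u. k i = k i' \<longrightarrow> \<bar>real (n i) / real (n i') - 1\<bar> \<le> \<epsilon>) \<and>
        (\<forall>i<u. \<forall>i'<u. k i' < k i \<longrightarrow> real (n i) / real (n i') \<le> \<epsilon>))"
      using magnitude_colouring[OF e] by auto
    have "\<exists>x n c. (\<forall>j<v. 0 < x j) \<and> (\<forall>i<u. 0 < n i \<and> col (n i) = c \<and>
        s i (\<lambda>j. real (x j)) = real (n i))"
      using conjunct2[OF ipr[unfolded image_partition_regular_real[OF A]], rule_format, OF col]
      unfolding s_def .
    then obtain x n c where xn: "\<forall>i<u. 0 < n i \<and> col (n i) = c \<and> s i (\<lambda>j. real (x j)) = real (n i)"
      by auto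
    then have n: "\<forall>i<u. 0 < n i \<and> col (n i) = c" and eq: "\<forall>i<u. s i (\<lambda>j. real (x j)) = real (n i)"
      by simp_all
    obtain k where k: "\<forall>i<u. k i < u"
      and same: "\<forall>i<u. \<forall>i'<u. k i = k i' \<longrightarrow> \<bar>real (n i) / real (n i') - 1\<bar> \<le> \<epsilon>"
      and smaller: "\<forall>i<u. \<forall>i'<u. k i' < k i \<longrightarrow> real (n i) / real (n i') \<le> \<epsilon>"
      using colour[THEN spec, THEN spec, THEN spec, THEN mp, OF n] by auto
    have "apx \<epsilon> (restrict k {..<u})"
      unfolding apx_def
    proof (intro allI impI)
      fix b assume "b < u"
      show "\<exists>x. (\<forall>j<v. 0 \<le> x j) \<and> (\<forall>i<u. b \<le> restrict k {..<u} i \<longrightarrow>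
          \<bar>s i x - (if restrict k {..<u} i = b then 1 else 0)\<bar> \<le> \<epsilon>)"
      proof (cases "\<exists>i<u. k i = b")
        case True
        then obtain i' where i': "i' < u" "k i' = b" by auto
        have "s i (\<lambda>j. real (x j) / real (n i')) = real (n i) / real (n i')" if "i < u" for i
          using eq that unfolding s_def by (simp add: sum_divide_distrib[symmetric])
        moreover have "\<bar>real (n i) / real (n i') - (if k i = b then 1 else 0)\<bar> \<le> \<epsilon>"
          if "i < u" "b \<le> k i" for i
          using same[rule_format, of i i'] smaller[rule_format, of i i'] that i' by auto
        ultimately show ?thesis
          by (intro exI[of _ "\<lambda>j. real (x j) / real (n i')"]) simp
      next
        \<comment> \<open>A skipped rank: all prescribed values are 0.\<close>
        case False
        then show ?thesis using e by (intro exI[of _ "\<lambda>_. 0"]) (auto simp: s_def)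
      qed
    qed
    moreover have "restrict k {..<u} \<in> F" using k unfolding F_def by auto
    ultimately show ?thesis by auto
  qed
  have "\<exists>k\<in>F. \<forall>\<epsilon>>0. apx \<epsilon> k"
  proof (rule ccontr)
    assume "\<not> ?thesis"
    \<comment> \<open>If every ranking failed at some tolerance, all of them would fail at the
      smallest one.\<close>
    then have "\<forall>k\<in>F. \<exists>\<epsilon>>0. \<not> apx \<epsilon> k" by auto
    then obtain e where e: "\<forall>k\<in>F. 0 < e k \<and> \<not> apx (e k) k" by metis
    have fin: "finite F" unfolding F_def by (intro finite_PiE) simp_all
    have "0 < Min (insert 1 (e ` F))" using fin e by simp
    then obtain k where k: "k \<in> F" "apx (Min (insert 1 (e ` F))) k" using ex by blast
    have "Min (insert 1 (e ` F)) \<le> e k" using fin k(1) by (intro Min_le) simp_all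
    then have "apx (e k) k" by (rule apx_mono[OF k(2)])
    moreover have "\<not> apx (e k) k" using e k(1) by auto
    ultimately show False by simp
  qed
  then obtain k where k: "k \<in> F" "\<forall>\<epsilon>>0. apx \<epsilon> k" by auto
  have "\<exists>x. (\<forall>j<v. 0 \<le> x j) \<and> (\<forall>i<u. b \<le> k i \<longrightarrow> s i x = (if k i = b then 1 else 0))" if b: "b < u" for b
  proof -
    let ?I = "{i. i < u \<and> b \<le> k i}"
    have "\<exists>x. (\<forall>j<v. 0 \<le> x j) \<and> (\<forall>i\<in>?I. (\<Sum>j<v. real_of_rat (A $$ (i, j)) * x j) = (if k i = b then 1 else 0))"
    proof (rule approximate_nonneg_solution_imp_solution)
      fix \<epsilon> :: real assume "0 < \<epsilon>"
      then have "apx \<epsilon> k" using k(2) by simp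
      then obtain x where "\<forall>j<v. 0 \<le> x j"
        "\<forall>i<u. b \<le> k i \<longrightarrow> \<bar>s i x - (if k i = b then 1 else 0)\<bar> \<le> \<epsilon>"
        using b unfolding apx_def by blast
      then show "\<exists>x. (\<forall>j<v. 0 \<le> x j) \<and>
          (\<forall>i\<in>?I. \<bar>(\<Sum>j<v. real_of_rat (A $$ (i, j)) * x j) - (if k i = b then 1 else 0)\<bar> \<le> \<epsilon>)"
        unfolding s_def by (intro exI[of _ x] conjI ballI) simp_all
    qed simp
    then obtain x where "\<forall>j<v. 0 \<le> x j"
      "\<forall>i\<in>?I. (\<Sum>j<v. real_of_rat (A $$ (i, j)) * x j) = (if k i = b then 1 else 0)" by blast
    then show ?thesis unfolding s_def by (intro exI[of _ x]) simp
  qed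
  moreover have "\<forall>i<u. k i < u" using k(1) unfolding F_def by auto
  ultimately show ?thesis unfolding s_def by (intro exI[of _ k]) simp
qed

section \<open>Clearing denominators and signs\<close>

lemma Ints_nonneg_imp_nat:
  assumes "x \<in> \<int>" "0 \<le> (x :: real)"
  shows "\<exists>m. x = real m"
proof -
  obtain z where z: "x = of_int z" using assms(1) by (auto elim: Ints_cases)
  then have "x = real (nat z)" using assms(2) by simp
  then show ?thesis by auto
qed

text \<open>Negative entries are removed by adding multiples of earlier columns. The last column, which comes
  after all leading entries and is therefore unconstrained, makes every coordinate positive.\<close>

lemma first_entries_structure:
  assumes A: "A \<in> carrier_mat u v" and ipr: "image_partition_regular A"
  shows "\<exists>d k h. 0 < d \<and> (\<forall>i<u. k i < u) \<and>
    (\<forall>b\<le>u. \<forall>i<u. \<exists>m. (\<Sum>j<v. real_of_rat (A $$ (i, j)) * real (h b j)) = real m) \<and>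
    (\<forall>i<u. (\<Sum>j<v. real_of_rat (A $$ (i, j)) * real (h (k i) j)) = real d) \<and>
    (\<forall>i<u. \<forall>b<k i. (\<Sum>j<v. real_of_rat (A $$ (i, j)) * real (h b j)) = 0) \<and>
    (\<forall>j<v. 0 < h u j)"
proof -
  define s where "s i g = (\<Sum>j<v. real_of_rat (A $$ (i, j)) * real (g j))" for i and g :: "nat \<Rightarrow> nat"
  have s_add: "s i (\<lambda>j. g j + N * g' j) = s i g + real N * s i g'" for i g g' N
    unfolding s_def by (simp add: sum.distrib sum_distrib_left algebra_simps)
  obtain D :: nat where D: "0 < D" "\<And>i j. i < u \<Longrightarrow> j < v \<Longrightarrow> real D * real_of_rat (A $$ (i, j)) \<in> \<int>"
    using common_denominator by metis
  have s_int: "s i (\<lambda>j. D * g j) \<in> \<int>" if "i < u" for i g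
  proof -
    have "s i (\<lambda>j. D * g j) = (\<Sum>j<v. real D * real_of_rat (A $$ (i, j)) * of_nat (g j))"
      unfolding s_def by (intro sum.cong) simp_all
    also have "\<dots> \<in> \<int>" by (intro Ints_sum Ints_mult[OF D(2)[OF that]]) auto
    finally show ?thesis .
  qed
  obtain k where k: "\<forall>i<u. k i < u" and sol: "\<forall>b<u. \<exists>x. (\<forall>j<v. 0 \<le> x j) \<and>
    (\<forall>i<u. b \<le> k i \<longrightarrow> (\<Sum>j<v. real_of_rat (A $$ (i, j)) * x j) = (if k i = b then 1 else 0))"
    using block_solutions[OF A ipr] by auto
  have "\<exists>q z. 0 < q \<and> (\<forall>i<u. b \<le> k i \<longrightarrow> s i z = (if k i = b then real q else 0))" if b: "b < u" for b
  proof -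
    obtain x where x: "\<forall>j<v. 0 \<le> x j" "\<forall>i<u. b \<le> k i \<longrightarrow>
        (\<Sum>j<v. real_of_rat (A $$ (i, j)) * x j) = (if k i = b then 1 else 0)"
      using sol b by auto
    let ?I = "{i. i < u \<and> b \<le> k i}"
    have "\<exists>q z. 0 < q \<and> (\<forall>i\<in>?I. (\<Sum>j<v. real_of_rat (A $$ (i, j)) * real (z j)) =
        real q * of_int (if k i = b then 1 else 0))"
      by (rule integral_nonneg_solution[OF _ D(1), where x = x]) (use D(2) x in auto)
    then obtain q z where qz: "0 < q" "\<forall>i\<in>?I. (\<Sum>j<v. real_of_rat (A $$ (i, j)) * real (z j)) =
        real q * of_int (if k i = b then 1 else 0)" by auto
    have "s i z = (if k i = b then real q else 0)" if "i < u" "b \<le> k i" for i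
      using qz(2) that unfolding s_def by auto
    then show ?thesis using qz(1) by (intro exI[of _ q] exI[of _ z]) simp
  qed
  then have "\<forall>b\<in>{..<u}. \<exists>q z. 0 < q \<and> (\<forall>i<u. b \<le> k i \<longrightarrow> s i z = (if k i = b then real q else 0))"
    by simp
  then obtain q z where qz: "\<forall>b\<in>{..<u}. 0 < q b \<and> (\<forall>i<u. b \<le> k i \<longrightarrow> s i (z b) = (if k i = b then real (q b) else 0))"
    by metis
  \<comment> \<open>Scaling column \<open>b\<close> by \<open>Q div q b\<close> gives all first
    entries the common value \<open>Q\<close>; the factor \<open>D\<close> makes the other entries
    integers.\<close>
  define Q where "Q = (\<Prod>b<u. q b)"
  define d where "d = D * Q"
  \<comment> \<open>No rank reaches \<open>u\<close>, so the last column can be chosen freely: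
    \<open>D\<close> in every coordinate is positive and has an integral image.\<close>
  define g where "g b j = (if b < u then D * (Q div q b * z b j) else D * 1)" for b j
  have Q: "0 < Q" unfolding Q_def using qz by (intro prod_pos) auto
  have d: "0 < d" unfolding d_def using D(1) Q by simp
  have g_int: "s i (g b) \<in> \<int>" if "i < u" for i b
  proof -
    have "g b = (\<lambda>j. D * (if b < u then Q div q b * z b j else 1))" unfolding g_def by auto
    then show ?thesis using s_int[OF that] by simp
  qed
  have g_eq: "s i (g b) = (if k i = b then real d else 0)" if "i < u" "b < u" "b \<le> k i" for i b
  proof -
    have "q b dvd Q" unfolding Q_def using that(2) by (intro dvd_prodI) auto
    then have Qq: "Q div q b * q b = Q" by simp
    have "s i (g b) = real (D * (Q div q b)) * s i (z b)"
      unfolding s_def g_def using that(2) by (simp add: sum_distrib_left algebra_simps)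
    also have "\<dots> = (if k i = b then real (D * (Q div q b * q b)) else 0)" using qz that by simp
    finally show ?thesis unfolding Qq d_def .
  qed
  \<comment> \<open>Blocks are repaired from \<open>b - 1\<close> down to 0. In the induction step,
    adding a multiple of \<open>g b\<close> fixes block \<open>b\<close> and, by
    \<open>g_eq\<close>, leaves later blocks alone; what it spoils lies in blocks below
    \<open>b\<close>, which the induction hypothesis repairs afterwards. The bound
    \<open>f j \<le> f' j\<close> keeps the last column positive.\<close>
  have nonneg: "\<exists>f'. (\<forall>j<v. f j \<le> f' j) \<and> (\<forall>i<u. s i f' \<in> \<int>) \<and> (\<forall>i<u. k i < b \<longrightarrow> 0 \<le> s i f') \<and>
      (\<forall>i<u. b \<le> k i \<longrightarrow> s i f' = s i f)" if "b \<le> u" "\<forall>i<u. s i f \<in> \<int>" for b f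
    using that
  proof (induction b arbitrary: f)
    case 0
    then show ?case by (intro exI[of _ f]) simp
  next
    case (Suc b)
    have b: "b \<le> u" "b < u" using Suc.prems(1) by simp_all
    obtain N :: nat where N: "(\<Sum>i<u. \<bar>s i f\<bar>) \<le> real N" using real_arch_simple by auto
    define f1 where "f1 j = f j + N * g b j" for j
    have f1: "s i f1 = s i f + real N * s i (g b)" for i
      unfolding f1_def using s_add[of i f N "g b"] by simp
    have "\<forall>i<u. s i f1 \<in> \<int>"
      unfolding f1 using Suc.prems(2) g_int by (intro allI impI Ints_add Ints_mult) auto
    from Suc.IH[OF b(1) this] obtain f' where f': "\<forall>j<v. f1 j \<le> f' j" "\<forall>i<u. s i f' \<in> \<int>"
      "\<forall>i<u. k i < b \<longrightarrow> 0 \<le> s i f'" "\<forall>i<u. b \<le> k i \<longrightarrow> s i f' = s i f1" by auto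
    have "0 \<le> s i f'" if i: "i < u" "k i < Suc b" for i
    proof (cases "k i = b")
      case True
      have "\<bar>s i f\<bar> \<le> (\<Sum>i<u. \<bar>s i f\<bar>)" using i(1) by (intro member_le_sum) auto
      moreover have "real N * 1 \<le> real N * real d" using d by (intro mult_left_mono) simp_all
      moreover have "s i f' = s i f + real N * real d"
        using f'(4) i(1) True g_eq[OF i(1) b(2)] unfolding f1 by simp
      ultimately show ?thesis using N by linarith
    next
      case False
      then show ?thesis using f'(3) i by simp
    qed
    moreover have "s i f' = s i f" if "i < u" "Suc b \<le> k i" for i
      using f'(4) that g_eq[OF that(1) b(2)] unfolding f1 by simp
    moreover have "f j \<le> f' j" if "j < v" for j
      using f'(1) that unfolding f1_def by (auto intro: order_trans[of _ "f j + N * g b j"])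
    ultimately show ?case using f'(2) by (intro exI[of _ f']) simp
  qed
  have "\<forall>b\<in>{..u}. \<exists>f'. (\<forall>j<v. g b j \<le> f' j) \<and> (\<forall>i<u. s i f' \<in> \<int>) \<and> (\<forall>i<u. k i < b \<longrightarrow> 0 \<le> s i f') \<and>
      (\<forall>i<u. b \<le> k i \<longrightarrow> s i f' = s i (g b))"
    using nonneg g_int by simp
  then obtain h where h: "\<forall>b\<in>{..u}. (\<forall>j<v. g b j \<le> h b j) \<and> (\<forall>i<u. s i (h b) \<in> \<int>) \<and>
      (\<forall>i<u. k i < b \<longrightarrow> 0 \<le> s i (h b)) \<and> (\<forall>i<u. b \<le> k i \<longrightarrow> s i (h b) = s i (g b))"
    by metis
  have h_eq: "s i (h b) = (if k i = b then real d else 0)" if "i < u" "b \<le> k i" for i b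
  proof -
    have "b < u" using k that by (meson le_less_trans)
    then show ?thesis using h g_eq[OF that(1) _ that(2)] that by simp
  qed
  have "\<exists>m. s i (h b) = real m" if "b \<le> u" "i < u" for i b
  proof (rule Ints_nonneg_imp_nat)
    show "s i (h b) \<in> \<int>" using h that by simp
    show "0 \<le> s i (h b)"
    proof (cases "k i < b")
      case True
      then show ?thesis using h that by simp
    next
      case False
      then show ?thesis using h_eq[OF that(2), of b] by simp
    qed
  qed
  moreover have "0 < h u j" if "j < v" for j
  proof -
    have "g u j \<le> h u j" using h that by simp
    then show ?thesis using D(1) unfolding g_def by simp
  qed
  ultimately show ?thesis
    using d k h_eq unfolding s_def by (intro exI[of _ d] exI[of _ k] exI[of _ h]) simp
qed

lemma mult_mat_vec_real_index:
  assumes "A \<in> carrier_mat u v" "x \<in> carrier_vec v" "i < u"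
  shows "(map_mat real_of_rat A *\<^sub>v x) $ i = (\<Sum>j<v. real_of_rat (A $$ (i, j)) * x $ j)"
  using assms by (simp add: scalar_prod_def atLeast0LessThan)

subsection \<open>From the integers to central sets near zero\<close>

context dense_semigroup
begin

text \<open>The solution is \<open>x = H y\<close>, with image \<open>(A H) y\<close>. The
  additional form \<open>last\<close> demands that \<open>d\<close> times the last coordinate of
  \<open>y\<close> lie in \<open>C\<close>, so this coordinate is not 0; as the last column of
  \<open>H\<close> is positive, the coordinates of \<open>x\<close> lie in \<open>S\<close> and not
  merely in \<open>insert 0 S\<close>.\<close>

lemma image_in_central_set:
  assumes A: "A \<in> carrier_mat u v" and ipr: "image_partition_regular A"
    and mult: "\<And>c::nat. c > 0 \<Longrightarrow> central_star_near_zero S ((\<lambda>s. real c * s) ` S)"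
    and p: "p \<in> minimal_idempotents_near_zero S" and C: "C \<in> p"
  shows "\<exists>x\<in>carrier_vec v. (\<forall>j<v. x $ j \<in> S) \<and> (\<forall>i<u. (map_mat real_of_rat A *\<^sub>v x) $ i \<in> C)"
proof -
  obtain d k h where d: "0 < d" and k: "\<forall>i<u. k i < u"
    and nat: "\<forall>b\<le>u. \<forall>i<u. \<exists>m. (\<Sum>j<v. real_of_rat (A $$ (i, j)) * real (h b j)) = real m"
    and first: "\<forall>i<u. (\<Sum>j<v. real_of_rat (A $$ (i, j)) * real (h (k i) j)) = real d"
    and zero: "\<forall>i<u. \<forall>b<k i. (\<Sum>j<v. real_of_rat (A $$ (i, j)) * real (h b j)) = 0"
    and pos_h: "\<forall>j<v. 0 < h u j"
    using first_entries_structure[OF A ipr] by (elim exE conjE) (rule that; assumption)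
  define m where "m i b = (SOME m. (\<Sum>j<v. real_of_rat (A $$ (i, j)) * real (h b j)) = real m)" for i b
  have m: "(\<Sum>j<v. real_of_rat (A $$ (i, j)) * real (h b j)) = real (m i b)" if "i < u" "b \<le> u" for i b
    using someI_ex[OF nat[rule_format, OF that(2,1)]] unfolding m_def .
  define last where "last = (\<lambda>b. if b = u then d else 0)"
  define \<Phi> where "\<Phi> = insert last (m ` {..<u})"
  \<comment> \<open>\<open>\<Phi>\<close> is a set of rows, in which different \<open>i\<close> may
    coincide, so the leading position has to be read off the row itself.\<close>
  define lead where "lead c = (LEAST b. c b \<noteq> 0)" for c :: "nat \<Rightarrow> nat"
  have lead_eq: "lead c = b" if "c b = d" "\<And>b'. b' < b \<Longrightarrow> c b' = 0" for c b
    unfolding lead_def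
  proof (rule Least_equality)
    show "c b \<noteq> 0" using that(1) d by simp
    show "b \<le> b'" if "c b' \<noteq> 0" for b' using \<open>\<And>b'. b' < b \<Longrightarrow> c b' = 0\<close> that by (meson not_le)
  qed
  have m_first: "m i (k i) = d" and m_zero: "\<And>b. b < k i \<Longrightarrow> m i b = 0" and lead_m: "lead (m i) = k i"
    if i: "i < u" for i
  proof -
    have ki: "k i < u" using k i by simp
    show 1: "m i (k i) = d" using m[OF i, of "k i"] first i ki by simp
    show 2: "m i b = 0" if "b < k i" for b using m[OF i, of b] zero i that ki by simp
    show "lead (m i) = k i" by (rule lead_eq[where c = "m i"]) (simp_all add: 1 2)
  qed
  have lead_last: "lead last = u" by (rule lead_eq) (simp_all add: last_def)
  have "\<exists>y. (\<forall>j. y j \<in> insert 0 S) \<and> (\<forall>b\<in>\<Phi>. linear_form (Suc u) b y \<in> C)"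
  proof (rule first_entries_in_central[OF p C d, where lead = lead])
    show "(\<lambda>s. real d * s) ` S \<in> p" using mult[OF d] p unfolding central_star_near_zero_def by auto
    show "finite \<Phi>" unfolding \<Phi>_def by simp
    show "lead b < Suc u" if "b \<in> \<Phi>" for b
      using that lead_last lead_m k unfolding \<Phi>_def by auto
    show "b (lead b) = d" if b: "b \<in> \<Phi>" for b
    proof -
      consider "b = last" | i where "i < u" "b = m i" using b unfolding \<Phi>_def by auto
      then show ?thesis
        by cases (simp_all add: lead_last lead_m m_first, simp add: last_def)
    qed
    show "b j = 0" if b: "b \<in> \<Phi>" and j: "j < lead b" for b j
    proof -
      consider "b = last" | i where "i < u" "b = m i" using b unfolding \<Phi>_def by auto
      then show ?thesis
      proof cases
        case 1
        then show ?thesis using j lead_last unfolding last_def by simp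
      next
        case 2
        then show ?thesis using j lead_m m_zero by simp
      qed
    qed
  qed
  then obtain y where y: "\<And>j. y j \<in> insert 0 S" and sol: "\<And>b. b \<in> \<Phi> \<Longrightarrow> linear_form (Suc u) b y \<in> C"
    by auto
  have CS: "C \<subseteq> S"
    by (rule ultrafilter_onD(1)[OF O_plusD(1)[OF minimal_idempotentD(1)[OF p]] C])
  have "linear_form (Suc u) last y = real d * y u"
  proof -
    have "(\<Sum>j<u. real (last j) * y j) = 0" unfolding last_def by (intro sum.neutral) auto
    then show ?thesis unfolding linear_form_def by (simp add: last_def)
  qed
  then have "real d * y u \<in> S" using sol[of last] CS unfolding \<Phi>_def by auto
  then have "0 < real d * y u" using pos by auto
  then have "y u \<noteq> 0" by auto
  then have yu: "y u \<in> S" using y[of u] by simp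
  define x where "x j = (\<Sum>b<Suc u. real (h b j) * y b)" for j
  have xS: "x j \<in> S" if "j < v" for j
  proof -
    have "(\<Sum>b<u. real (h b j) * y b) \<in> insert 0 S"
      by (intro insert_zero_sum insert_zero_mult y) simp
    moreover have "real (h u j) * y u \<in> S"
    proof -
      have "real (h u j) * y u \<in> insert 0 S" by (rule insert_zero_mult[OF y])
      moreover have "real (h u j) * y u \<noteq> 0" using pos_h that \<open>y u \<noteq> 0\<close> by simp
      ultimately show ?thesis by simp
    qed
    ultimately have "(\<Sum>b<u. real (h b j) * y b) + real (h u j) * y u \<in> S" using S_add by auto
    then show ?thesis unfolding x_def by simp
  qed
  have "(\<Sum>j<v. real_of_rat (A $$ (i, j)) * x j) \<in> C" if i: "i < u" for i
  proof -
    have "(\<Sum>j<v. real_of_rat (A $$ (i, j)) * x j) =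
        (\<Sum>j<v. \<Sum>b<Suc u. real_of_rat (A $$ (i, j)) * real (h b j) * y b)"
      unfolding x_def sum_distrib_left by (simp only: mult.assoc)
    also have "\<dots> = (\<Sum>b<Suc u. \<Sum>j<v. real_of_rat (A $$ (i, j)) * real (h b j) * y b)"
      by (rule sum.swap)
    also have "\<dots> = (\<Sum>b<Suc u. real (m i b) * y b)"
      by (intro sum.cong refl) (use m[OF i] in \<open>simp add: sum_distrib_right[symmetric]\<close>)
    also have "\<dots> = linear_form (Suc u) (m i) y" unfolding linear_form_def ..
    finally show ?thesis using sol[of "m i"] i unfolding \<Phi>_def by simp
  qed
  then show ?thesis
    using xS mult_mat_vec_real_index[OF A, of "Matrix.vec v x"]
    by (intro bexI[of _ "Matrix.vec v x"]) simp_all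
qed

end

subsection \<open>From central sets near zero to the integers\<close>

text \<open>Dirichlet's theorem gives common return times for finitely many reals, which is the
  finite intersection property; the ultrafilter then handles all reals at once.\<close>

lemma recurrence_ultrafilter:
  "\<exists>U. ultrafilter_on (UNIV :: nat set) U \<and>
    (\<forall>s \<epsilon> :: real. 0 < \<epsilon> \<longrightarrow> {q. 0 < q \<and> \<bar>real q * s - of_int (round (real q * s))\<bar> < \<epsilon>} \<in> U)"
proof -
  define R where "R = (\<lambda>(s, \<epsilon>). {q :: nat. 0 < q \<and> \<bar>real q * s - of_int (round (real q * s))\<bar> < \<epsilon>})"
  have "\<exists>U. ultrafilter_on (UNIV :: nat set) U \<and> R ` (UNIV \<times> {0<..}) \<subseteq> U"
  proof (rule ultrafilter_on_extension)
    fix \<G> assume \<G>: "finite \<G>" "\<G> \<subseteq> R ` (UNIV \<times> {0<..})"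
    obtain E where E: "E \<subseteq> UNIV \<times> {0<..}" "finite E" "\<G> = R ` E"
      using finite_subset_image[OF \<G>] by blast
    obtain n f where f: "E = f ` {i::nat. i < n}"
      using E(2) finite_imp_nat_seg_image_inj_on by metis
    define e where "e = Min (insert 1 (snd ` E))"
    have e: "0 < e" unfolding e_def using E(1,2) by (subst Min_gr_iff) auto
    obtain N :: nat where N: "0 < N" "1 / real N < e"
      using reals_Archimedean[OF e] by (metis inverse_eq_divide zero_less_Suc)
    have "\<exists>q p. 0 < q \<and> (\<forall>i<n. \<bar>of_int q * fst (f i) - of_int (p i)\<bar> < 1 / real N)"
    proof (rule Dirichlet_approx_simult[OF N(1), where \<theta> = "\<lambda>i. fst (f i)" and n = n])
      fix q :: int and p :: "nat \<Rightarrow> int"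
      assume "0 < q" "\<And>i. i < n \<Longrightarrow> \<bar>of_int q * fst (f i) - of_int (p i)\<bar> < 1 / real N"
      then show ?thesis by (intro exI[of _ q] exI[of _ p]) simp
    qed
    then obtain q p where q: "0 < q" and p: "\<And>i. i < n \<Longrightarrow> \<bar>of_int q * fst (f i) - of_int (p i)\<bar> < 1 / real N"
      by auto
    have "nat q \<in> R c" if c: "c \<in> E" for c
    proof -
      obtain i where i: "i < n" "c = f i" using c f by auto
      have q': "real (nat q) = of_int q" using q by simp
      have "\<bar>of_int q * fst c - of_int (round (of_int q * fst c))\<bar> \<le> \<bar>of_int q * fst c - of_int (p i)\<bar>"
        by (rule round_diff_minimal)
      also have "\<dots> < e" using p[OF i(1)] i(2) N(2) by simp
      also have "e \<le> snd c" unfolding e_def using c E(2) by (intro Min_le) auto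
      finally show ?thesis using q q' unfolding R_def by (simp add: case_prod_beta)
    qed
    then have "nat q \<in> UNIV \<inter> \<Inter>\<G>" unfolding E(3) by simp
    then show "UNIV \<inter> \<Inter>\<G> \<noteq> {}" by auto
  qed simp
  then obtain U where U: "ultrafilter_on UNIV U" "R ` (UNIV \<times> {0<..}) \<subseteq> U" by auto
  have "R (s, \<epsilon>) \<in> U" if "0 < \<epsilon>" for s \<epsilon> using U(2) that by (intro subsetD[OF U(2)] imageI) simp
  then show ?thesis using U(1) unfolding R_def by (intro exI[of _ U]) simp
qed

context dense_semigroup
begin

text \<open>A colouring of the positive integers is transported to \<open>S\<close> by colouring \<open>s\<close> with the limit, along
  an ultrafilter of simultaneous return times \<open>q\<close>, of the colour of the integer nearest to \<open>q s\<close>.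
  Rounding preserves any finite number of rational linear relations for suitable \<open>q\<close>.\<close>

lemma image_partition_regular_if_image_in_central_set:
  assumes A: "A \<in> carrier_mat u v"
    and central: "\<And>C. C \<subseteq> S \<Longrightarrow> central_near_zero S C \<Longrightarrow>
      \<exists>x\<in>carrier_vec v. (\<forall>j<v. x $ j \<in> S) \<and> (\<forall>i<u. (map_mat real_of_rat A *\<^sub>v x) $ i \<in> C)"
  shows "image_partition_regular A"
proof -
  obtain p where p: "p \<in> minimal_idempotents_near_zero S" using minimal_idempotent_exists by auto
  have pu: "ultrafilter_on S p" by (rule O_plusD(1)[OF minimal_idempotentD(1)[OF p]])
  have ex: "\<exists>x. (\<forall>j<v. x j \<in> S) \<and> (\<forall>i<u. (\<Sum>j<v. real_of_rat (A $$ (i, j)) * x j) \<in> C)"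
    if C: "C \<in> p" for C
  proof -
    have CS: "C \<subseteq> S" by (rule ultrafilter_onD(1)[OF pu C])
    have "central_near_zero S C" using CS C p unfolding central_near_zero_def by auto
    from central[OF CS this] obtain x where x: "x \<in> carrier_vec v" "\<forall>j<v. x $ j \<in> S"
      "\<forall>i<u. (map_mat real_of_rat A *\<^sub>v x) $ i \<in> C" by auto
    then show ?thesis
      using mult_mat_vec_real_index[OF A x(1)] by (intro exI[of _ "\<lambda>j. x $ j"]) simp
  qed
  have rows: "Matrix.row A i \<noteq> 0\<^sub>v v" if i: "i < u" for i
  proof
    assume "Matrix.row A i = 0\<^sub>v v"
    then have "A $$ (i, j) = 0" if "j < v" for j
      using A i that by (metis carrier_matD index_row(1) index_zero_vec(1))
    moreover obtain x where "\<forall>i<u. (\<Sum>j<v. real_of_rat (A $$ (i, j)) * x j) \<in> S"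
      using ex[OF ultrafilter_onD(2)[OF pu]] by auto
    ultimately have "0 \<in> S" using i by (metis (no_types, lifting) lessThan_iff mult_zero_left of_rat_0 sum.neutral)
    then show False using pos by auto
  qed
  have "\<exists>x n c. (\<forall>j<v. 0 < x j) \<and> (\<forall>i<u. 0 < n i \<and> col (n i) = c \<and>
      (\<Sum>j<v. real_of_rat (A $$ (i, j)) * real (x j)) = real (n i))"
    if fin: "finite (col ` {0<..})" for col :: "nat \<Rightarrow> nat"
  proof -
    obtain U where U: "ultrafilter_on (UNIV :: nat set) U"
      and near: "\<And>s \<epsilon> :: real. 0 < \<epsilon> \<Longrightarrow> {q. 0 < q \<and> \<bar>real q * s - of_int (round (real q * s))\<bar> < \<epsilon>} \<in> U"
      using recurrence_ultrafilter by auto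
    define nr where "nr q s = nat (round (real q * s))" for q s
    \<comment> \<open>An error below \<open>s\<close>, which is at most \<open>q * s\<close>, keeps
      the rounded value away from 0.\<close>
    have nr: "0 < nr q s \<and> real (nr q s) = of_int (round (real q * s))"
      if "0 < q" "0 < s" "\<bar>real q * s - of_int (round (real q * s))\<bar> < s" for q s
    proof -
      have "1 * s \<le> real q * s" using that(1,2) by (intro mult_right_mono) simp_all
      then have "0 < (of_int (round (real q * s)) :: real)" using that(3) by linarith
      then have "0 < round (real q * s)" by simp
      then show ?thesis unfolding nr_def by simp
    qed
    define near_set where "near_set s \<epsilon> = {q\<in>UNIV. 0 < q \<and> \<bar>real q * s - of_int (round (real q * s))\<bar> < \<epsilon>}"
      for s \<epsilon> :: real
    have near': "near_set s \<epsilon> \<in> U" if "0 < \<epsilon>" for s \<epsilon> using near[OF that] unfolding near_set_def by simp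
    define E where "E s c = {q\<in>UNIV. 0 < nr q s \<and> col (nr q s) = c}" for s c
    have E_ex: "\<exists>c\<in>col ` {0<..}. E s c \<in> U" if s: "s \<in> S" for s
    proof -
      have "0 < s" using pos s by auto
      have "{q\<in>UNIV. \<exists>c\<in>col ` {0<..}. 0 < nr q s \<and> col (nr q s) = c} \<in> U"
        by (rule ultrafilter_onD(5)[OF U near'[OF \<open>0 < s\<close>, of s]])
          (use nr \<open>0 < s\<close> in \<open>auto simp: near_set_def\<close>)
      from ultrafilter_on_finite_Bex[OF U fin this] show ?thesis unfolding E_def .
    qed
    then have "{s\<in>S. \<exists>c\<in>col ` {0<..}. E s c \<in> U} = S" by auto
    then have "{s\<in>S. \<exists>c\<in>col ` {0<..}. E s c \<in> U} \<in> p" using ultrafilter_onD(2)[OF pu] by simp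
    \<comment> \<open>A second choice of colour: each \<open>s\<close> has a limit colour along
      \<open>U\<close>, and \<open>p\<close> selects one whose class is central near zero.\<close>
    from ultrafilter_on_finite_Bex[OF pu fin this] obtain c where c: "{s\<in>S. E s c \<in> U} \<in> p" by auto
    from ex[OF this] obtain x where x: "\<forall>j<v. x j \<in> S"
      and "\<forall>i<u. (\<Sum>j<v. real_of_rat (A $$ (i, j)) * x j) \<in> {s\<in>S. E s c \<in> U}" by auto
    define y where "y i = (\<Sum>j<v. real_of_rat (A $$ (i, j)) * x j)" for i
    have y: "y i \<in> S" "E (y i) c \<in> U" if "i < u" for i
      using \<open>\<forall>i<u. (\<Sum>j<v. real_of_rat (A $$ (i, j)) * x j) \<in> {s\<in>S. E s c \<in> U}\<close> that unfolding y_def by auto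
    obtain D :: nat where D: "0 < D" "\<And>i j. i < u \<Longrightarrow> j < v \<Longrightarrow> real D * real_of_rat (A $$ (i, j)) \<in> \<int>"
      using common_denominator by metis
    let ?K = "\<lambda>i. real D * ((\<Sum>j<v. \<bar>real_of_rat (A $$ (i, j))\<bar>) + 1)"
    have K0: "0 \<le> ?K i" for i by (simp add: sum_nonneg)
    \<comment> \<open>Below \<open>1 / ?K i\<close> for every row, the threshold in
      \<open>rounded_relation\<close>.\<close>
    define \<delta> where "\<delta> = 1 / ((\<Sum>i<u. ?K i) + 1)"
    have sumK: "0 \<le> (\<Sum>i<u. ?K i)" by (intro sum_nonneg K0)
    then have \<delta>: "0 < \<delta>" unfolding \<delta>_def by simp
    have K: "\<delta> * ?K i < 1" if "i < u" for i
    proof -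
      have "?K i \<le> (\<Sum>i<u. ?K i)" using that K0 by (intro member_le_sum) auto
      then show ?thesis using sumK unfolding \<delta>_def by (simp add: divide_less_eq)
    qed
    \<comment> \<open>The tolerance \<open>\<delta>\<close> makes the relations exact, the tolerance
      \<open>y i\<close> keeps the rounded values positive.\<close>
    define G1 where "G1 = {q\<in>UNIV. \<forall>i\<in>{..<u}. q \<in> E (y i) c \<and> q \<in> near_set (y i) (min \<delta> (y i))}"
    define G2 where "G2 = {q\<in>UNIV. \<forall>j\<in>{..<v}. q \<in> near_set (x j) (min \<delta> (x j))}"
    have "G1 \<in> U"
      unfolding G1_def
    proof (rule ultrafilter_on_finite_Ball[OF U])
      fix i assume "i \<in> {..<u}"
      then have i: "i < u" by simp
      have "E (y i) c \<inter> near_set (y i) (min \<delta> (y i)) \<in> U"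
        using y[OF i] pos \<delta> by (intro ultrafilter_onD(4)[OF U] near') auto
      then show "{q\<in>UNIV. q \<in> E (y i) c \<and> q \<in> near_set (y i) (min \<delta> (y i))} \<in> U"
        by (simp add: Int_def)
    qed simp
    moreover have "G2 \<in> U"
      unfolding G2_def
    proof (rule ultrafilter_on_finite_Ball[OF U])
      fix j assume "j \<in> {..<v}"
      then have "0 < x j" using x pos by auto
      then show "{q\<in>UNIV. q \<in> near_set (x j) (min \<delta> (x j))} \<in> U"
        using near'[of "min \<delta> (x j)" "x j"] \<delta> by simp
    qed simp
    ultimately have "G1 \<inter> G2 \<in> U" by (rule ultrafilter_onD(4)[OF U])
    then have "G1 \<inter> G2 \<noteq> {}" using ultrafilter_onD(3)[OF U] by auto
    then obtain q where "q \<in> G1" "q \<in> G2" by auto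
    then have qy: "\<forall>i<u. q \<in> E (y i) c \<and> q \<in> near_set (y i) (min \<delta> (y i))"
      and qx: "\<forall>j<v. q \<in> near_set (x j) (min \<delta> (x j))"
      unfolding G1_def G2_def by simp_all
    have xj: "0 < nr q (x j)" "real (nr q (x j)) = of_int (round (real q * x j))"
      "\<bar>real q * x j - of_int (round (real q * x j))\<bar> \<le> \<delta>" if j: "j < v" for j
    proof -
      have "0 < x j" using x pos j by auto
      moreover have "0 < q" "\<bar>real q * x j - of_int (round (real q * x j))\<bar> < min \<delta> (x j)"
        using qx j unfolding near_set_def by auto
      ultimately show "0 < nr q (x j)" "real (nr q (x j)) = of_int (round (real q * x j))"
        "\<bar>real q * x j - of_int (round (real q * x j))\<bar> \<le> \<delta>"
        using nr[of q "x j"] by simp_all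
    qed
    have yi: "0 < nr q (y i)" "real (nr q (y i)) = of_int (round (real q * y i))"
      "\<bar>real q * y i - of_int (round (real q * y i))\<bar> \<le> \<delta>" "col (nr q (y i)) = c" if i: "i < u" for i
    proof -
      have "0 < y i" using y(1)[OF i] pos by auto
      moreover have "0 < q" "\<bar>real q * y i - of_int (round (real q * y i))\<bar> < min \<delta> (y i)"
        using qy i unfolding near_set_def by auto
      ultimately show "0 < nr q (y i)" "real (nr q (y i)) = of_int (round (real q * y i))"
        "\<bar>real q * y i - of_int (round (real q * y i))\<bar> \<le> \<delta>"
        using nr[of q "y i"] by simp_all
      show "col (nr q (y i)) = c" using qy i unfolding E_def by simp
    qed
    have "(\<Sum>j<v. real_of_rat (A $$ (i, j)) * real (nr q (x j))) = real (nr q (y i))" if i: "i < u" for i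
    proof -
      have "(\<Sum>j<v. real_of_rat (A $$ (i, j)) * of_int (round (real q * x j))) = of_int (round (real q * y i))"
        by (rule rounded_relation[OF D(2)[OF i] _ D(1) xj(3) yi(3)[OF i] _ K[OF i]])
          (auto simp: y_def intro!: Ints_mult)
      then show ?thesis using xj(2) yi(2)[OF i] by simp
    qed
    then show ?thesis
      using xj(1) yi(1,4) by (intro exI[of _ "\<lambda>j. nr q (x j)"] exI[of _ "\<lambda>i. nr q (y i)"] exI[of _ c]) simp
  qed
  then show ?thesis using rows unfolding image_partition_regular_real[OF A] by simp
qed

end

theorem theorem2p14:
  fixes S :: "real set" and u v :: nat and A :: "rat mat"
  assumes "S \<subseteq> {0<..}"
    and "\<And>x y. x \<in> S \<Longrightarrow> y \<in> S \<Longrightarrow> x + y \<in> S"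
    and "{0<..} \<subseteq> closure S"
    and "\<And>c::nat. c > 0 \<Longrightarrow> central_star_near_zero S ((\<lambda>s. real c * s) ` S)"
    and "u > 0" and "v > 0" and "A \<in> carrier_mat u v"
  shows "image_partition_regular A \<longleftrightarrow>
    (\<forall>C. C \<subseteq> S \<and> central_near_zero S C \<longrightarrow>
      (\<exists>x \<in> carrier_vec v. (\<forall>j < v. x $ j \<in> S) \<and>
        (\<forall>i < u. (map_mat real_of_rat A *\<^sub>v x) $ i \<in> C)))"
proof -
  interpret dense_semigroup S by unfold_locales (use assms(1-3) in auto)
  show ?thesis
  proof (intro iffI allI impI)
    fix C assume ipr: "image_partition_regular A" and "C \<subseteq> S \<and> central_near_zero S C"
    then obtain p where p: "p \<in> minimal_idempotents_near_zero S" "C \<in> p"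
      unfolding central_near_zero_def by auto
    show "\<exists>x\<in>carrier_vec v. (\<forall>j<v. x $ j \<in> S) \<and> (\<forall>i<u. (map_mat real_of_rat A *\<^sub>v x) $ i \<in> C)"
      by (rule image_in_central_set[OF assms(7) ipr _ p]) (rule assms(4))
  next
    assume "\<forall>C. C \<subseteq> S \<and> central_near_zero S C \<longrightarrow>
      (\<exists>x \<in> carrier_vec v. (\<forall>j < v. x $ j \<in> S) \<and> (\<forall>i < u. (map_mat real_of_rat A *\<^sub>v x) $ i \<in> C))"
    then show "image_partition_regular A"
      by (intro image_partition_regular_if_image_in_central_set[OF assms(7)]) simp
  qed
qed

end
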